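(* Let $k_1,k_2,k_3\in\mathbb{R}$ and $N\ge1$. The multi-peakon solutions of $$m_t+k_1[(u^2-u_x^2)m]_x+k_2(u^2m_x+3uu_xm)+k_3(um_x+2u_xm)=0,\qquad m=u-u_{xx},\quad x\in\mathbb{R},\ t>0,$$ in the weak sense defined in the context, are given by $$u_{npm}(t,x)=\sum_{i=1}^Np_i(t)e^{-|x-q_i(t)|};$$ that is, such a function is a weak solution on $[0,T)$ whenever the time-dependent positions $q_i(t)$, ordered as $q_1(t)<q_2(t)<\cdots<q_N(t)$, and amplitudes $p_i(t)$ are continuously differentiable functions on $[0,T)$ satisfying the dynamical system $$\begin{cases}\dot p_i(t)=\displaystyle p_i(t)\sum_{j=1}^Np_j(t)\,\mathrm{sgn}(q_i-q_j)e^{-|q_i-q_j|}\left[k_2\left(\sum_{k=1}^Np_k(t)e^{-|q_i-q_k|}\right)+k_3\right],\\[3mm] \dot q_i(t)=\displaystyle-\frac{k_1}{3}p_i^2(t)-k_1\left(\sum_{j=1}^Np_j(t)\,\mathrm{sgn}(q_i-q_j)e^{-|q_i-q_j|}\right)^2+(k_1+k_2)\left(\sum_{j=1}^Np_j(t)e^{-|q_i-q_j|}\right)^2+k_3\sum_{j=1}^Np_j(t)e^{-|q_i-q_j|}\end{cases}$$ for $i=1,2,\dots,N$.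
   Context: Convention: $\mathrm{sgn}(0)=0$. Let $p(x)=\frac12e^{-|x|}$ and let $*$ denote convolution in $x$. For $u_0\in W^{1,3}(\mathbb{R})$, a function $u\in L^\infty_{loc}([0,T),W^{1,3}_{loc}(\mathbb{R}))$ is a weak solution of the equation with initial datum $u_0$ (here $u_0=u_{npm}(0,\cdot)$) if $$\begin{aligned}&\int_0^T\!\!\int_{\mathbb{R}}\Big\{u\varphi_t+\tfrac{k_1+k_2}{3}u^3\varphi_x+\tfrac{k_1}{3}u_x^3\varphi+\tfrac{k_3}{2}u^2\varphi_x-p*\big[(\tfrac{k_1}{3}+\tfrac{k_2}{2})u_x^3\big]\varphi\\&\quad+p*\big[(\tfrac{2k_1}{3}+k_2)u^3+(k_1+\tfrac{3k_2}{2})uu_x^2+k_3u^2+\tfrac{k_3}{2}u_x^2\big]\varphi_x\Big\}dx\,dt+\int_{\mathbb{R}}u_0(x)\varphi(0,x)\,dx=0\end{aligned}$$ for every smooth test function $\varphi\in C_c^\infty([0,T)\times\mathbb{R})$. *)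

theory Defs
  imports "HOL-Analysis.Analysis"
begin

text \<open>
  Functions of \<open>(t, x)\<close> are curried, and an index such as \<open>u\<^sub>x\<close>
  refers to the second argument. The lifespan is a positive extended real, so that
  \<open>[0, \<infinity>)\<close> is included.
\<close>

definition time_dom :: "ereal \<Rightarrow> real set" where
  "time_dom T = {t. 0 \<le> t \<and> ereal t < T}"

definition test_fun :: "(real \<Rightarrow> real) \<Rightarrow> bool" where
  "test_fun \<psi> \<longleftrightarrow>
     (\<forall>n x. ((deriv ^^ n) \<psi>) differentiable (at x)) \<and>
     (\<exists>K. compact K \<and> (\<forall>x. x \<notin> K \<longrightarrow> \<psi> x = 0))"

text \<open>The time derivative is one-sided at \<open>t = 0\<close>.\<close>

definition dt :: "ereal \<Rightarrow> (real \<Rightarrow> real \<Rightarrow> real) \<Rightarrow> real \<Rightarrow> real \<Rightarrow> real" where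
  "dt T \<phi> t x = vector_derivative (\<lambda>s. \<phi> s x) (at t within time_dom T)"

definition dx :: "(real \<Rightarrow> real \<Rightarrow> real) \<Rightarrow> real \<Rightarrow> real \<Rightarrow> real" where
  "dx \<phi> t x = deriv (\<phi> t) x"

primrec Ck_strip :: "ereal \<Rightarrow> nat \<Rightarrow> (real \<Rightarrow> real \<Rightarrow> real) \<Rightarrow> bool" where
  "Ck_strip T 0 \<phi> \<longleftrightarrow> continuous_on (time_dom T \<times> UNIV) (\<lambda>(t, x). \<phi> t x)"
| "Ck_strip T (Suc k) \<phi> \<longleftrightarrow>
     continuous_on (time_dom T \<times> UNIV) (\<lambda>(t, x). \<phi> t x) \<and>
     (\<forall>t\<in>time_dom T. \<forall>x. (\<lambda>s. \<phi> s x) differentiable (at t within time_dom T)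
                        \<and> \<phi> t differentiable (at x)) \<and>
     Ck_strip T k (dt T \<phi>) \<and> Ck_strip T k (dx \<phi>)"

text \<open>The compact support may meet the line \<open>t = 0\<close>, but stays away from \<open>t = T\<close>.\<close>

definition test_fun_strip :: "ereal \<Rightarrow> (real \<Rightarrow> real \<Rightarrow> real) \<Rightarrow> bool" where
  "test_fun_strip T \<phi> \<longleftrightarrow>
     (\<forall>k. Ck_strip T k \<phi>) \<and>
     (\<exists>K. compact K \<and> K \<subseteq> time_dom T \<times> UNIV \<and>
          (\<forall>t\<in>time_dom T. \<forall>x. (t, x) \<notin> K \<longrightarrow> \<phi> t x = 0))"

definition has_weak_deriv :: "(real \<Rightarrow> real) \<Rightarrow> (real \<Rightarrow> real) \<Rightarrow> bool" where
  "has_weak_deriv f g \<longleftrightarrow>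
     (\<forall>K. compact K \<longrightarrow> set_integrable lebesgue K f \<and> set_integrable lebesgue K g) \<and>
     (\<forall>\<psi>. test_fun \<psi> \<longrightarrow>
        (LINT x|lebesgue. f x * deriv \<psi> x) = - (LINT x|lebesgue. g x * \<psi> x))"

text \<open>Measurability of \<open>f\<close> and \<open>g\<close> is part of their local integrability.\<close>

definition W13 :: "(real \<Rightarrow> real) set" where
  "W13 = {f. \<exists>g. has_weak_deriv f g \<and>
             integrable lebesgue (\<lambda>x. \<bar>f x\<bar> ^ 3) \<and> integrable lebesgue (\<lambda>x. \<bar>g x\<bar> ^ 3)}"

definition W13_norm_on :: "real set \<Rightarrow> (real \<Rightarrow> real) \<Rightarrow> (real \<Rightarrow> real) \<Rightarrow> real" where
  "W13_norm_on K f g =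
     ((LINT x:K|lebesgue. \<bar>f x\<bar> ^ 3) + (LINT x:K|lebesgue. \<bar>g x\<bar> ^ 3)) powr (1 / 3)"

text \<open>
  \<open>u \<in> L\<^sup>\<infinity>\<^sub>l\<^sub>o\<^sub>c([0,T), W\<^sup>1\<^sup>,\<^sup>3\<^sub>l\<^sub>o\<^sub>c(\<real>))\<close>, with a jointly measurable representative \<open>ux\<close> of the weak
  \<open>x\<close>-derivative. Strong measurability in \<open>t\<close> is expressed by joint
  measurability in \<open>(t, x)\<close>.
\<close>

definition Linf_loc_W13_loc ::
  "ereal \<Rightarrow> (real \<Rightarrow> real \<Rightarrow> real) \<Rightarrow> (real \<Rightarrow> real \<Rightarrow> real) \<Rightarrow> bool" where
  "Linf_loc_W13_loc T u ux \<longleftrightarrow>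
     (\<lambda>(t, x). u t x) \<in> borel_measurable (lebesgue_on (time_dom T \<times> UNIV)) \<and>
     (\<lambda>(t, x). ux t x) \<in> borel_measurable (lebesgue_on (time_dom T \<times> UNIV)) \<and>
     (AE t in lebesgue. t \<in> time_dom T \<longrightarrow> has_weak_deriv (u t) (ux t)) \<and>
     (\<forall>J K. compact J \<and> J \<subseteq> time_dom T \<and> compact K \<longrightarrow>
        (\<exists>C. AE t in lebesgue. t \<in> J \<longrightarrow>
           set_integrable lebesgue K (\<lambda>x. \<bar>u t x\<bar> ^ 3) \<and>
           set_integrable lebesgue K (\<lambda>x. \<bar>ux t x\<bar> ^ 3) \<and>
           W13_norm_on K (u t) (ux t) \<le> C))"

definition pker :: "real \<Rightarrow> real" where
  "pker x = 1 / 2 * exp (- \<bar>x\<bar>)"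

definition conv :: "(real \<Rightarrow> real) \<Rightarrow> (real \<Rightarrow> real) \<Rightarrow> real \<Rightarrow> real" where
  "conv f g x = (LINT y|lebesgue. f (x - y) * g y)"

definition nonloc1 ::
  "real \<Rightarrow> real \<Rightarrow> (real \<Rightarrow> real \<Rightarrow> real) \<Rightarrow> real \<Rightarrow> real \<Rightarrow> real" where
  "nonloc1 k1 k2 ux t x = (k1 / 3 + k2 / 2) * ux t x ^ 3"

definition nonloc2 ::
  "real \<Rightarrow> real \<Rightarrow> real \<Rightarrow> (real \<Rightarrow> real \<Rightarrow> real) \<Rightarrow> (real \<Rightarrow> real \<Rightarrow> real)
    \<Rightarrow> real \<Rightarrow> real \<Rightarrow> real" where
  "nonloc2 k1 k2 k3 u ux t x =
     (2 * k1 / 3 + k2) * u t x ^ 3 + (k1 + 3 * k2 / 2) * u t x * ux t x ^ 2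
     + k3 * u t x ^ 2 + k3 / 2 * ux t x ^ 2"

definition weak_integrand ::
  "real \<Rightarrow> real \<Rightarrow> real \<Rightarrow> ereal \<Rightarrow> (real \<Rightarrow> real \<Rightarrow> real) \<Rightarrow> (real \<Rightarrow> real \<Rightarrow> real)
    \<Rightarrow> (real \<Rightarrow> real \<Rightarrow> real) \<Rightarrow> real \<Rightarrow> real \<Rightarrow> real" where
  "weak_integrand k1 k2 k3 T u ux \<phi> t x =
     u t x * dt T \<phi> t x
     + (k1 + k2) / 3 * u t x ^ 3 * dx \<phi> t x
     + k1 / 3 * ux t x ^ 3 * \<phi> t x
     + k3 / 2 * u t x ^ 2 * dx \<phi> t x
     - conv pker (nonloc1 k1 k2 ux t) x * \<phi> t x
     + conv pker (nonloc2 k1 k2 k3 u ux t) x * dx \<phi> t x"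

text \<open>
  Weak solutions on \<open>[0,T)\<close> of
  \<open>m\<^sub>t + k1 [(u\<^sup>2 - u\<^sub>x\<^sup>2) m]\<^sub>x + k2 (u\<^sup>2 m\<^sub>x + 3 u u\<^sub>x m) + k3 (u m\<^sub>x + 2 u\<^sub>x m) = 0\<close>,
  \<open>m = u - u\<^sub>x\<^sub>x\<close>, with initial datum \<open>u0\<close>. A Bochner integral that does not
  exist has the value 0 in HOL, so the existence of the convolutions and of the
  integrals is required explicitly; it does not follow from
  local integrability of \<open>u\<close> and \<open>ux\<close>, the kernel not having compact support.
\<close>

definition weak_solution ::
  "real \<Rightarrow> real \<Rightarrow> real \<Rightarrow> ereal \<Rightarrow> (real \<Rightarrow> real) \<Rightarrow> (real \<Rightarrow> real \<Rightarrow> real) \<Rightarrow> bool" where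
  "weak_solution k1 k2 k3 T u0 u \<longleftrightarrow>
     u0 \<in> W13 \<and>
     (\<exists>ux. Linf_loc_W13_loc T u ux \<and>
        (AE t in lebesgue. t \<in> time_dom T \<longrightarrow>
           (\<forall>x. integrable lebesgue (\<lambda>y. pker (x - y) * nonloc1 k1 k2 ux t y) \<and>
                integrable lebesgue (\<lambda>y. pker (x - y) * nonloc2 k1 k2 k3 u ux t y))) \<and>
        (\<forall>\<phi>. test_fun_strip T \<phi> \<longrightarrow>
           set_integrable lebesgue (time_dom T \<times> UNIV)
             (\<lambda>(t, x). weak_integrand k1 k2 k3 T u ux \<phi> t x) \<and>
           integrable lebesgue (\<lambda>x. u0 x * \<phi> 0 x) \<and>
           (LINT t:time_dom T|lebesgue. LINT x|lebesgue. weak_integrand k1 k2 k3 T u ux \<phi> t x)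
             + (LINT x|lebesgue. u0 x * \<phi> 0 x) = 0))"

definition multipeakon ::
  "nat \<Rightarrow> (nat \<Rightarrow> real \<Rightarrow> real) \<Rightarrow> (nat \<Rightarrow> real \<Rightarrow> real) \<Rightarrow> real \<Rightarrow> real \<Rightarrow> real" where
  "multipeakon N p q t x = (\<Sum>i=1..N. p i t * exp (- \<bar>x - q i t\<bar>))"

end

theory Submission
  imports Defs
begin

text \<open>
  Write \<open>u\<close> for the multipeakon and \<open>v\<close> for its slope, where \<open>sgn 0 = 0\<close> gives \<open>v\<close> at a peak the
  mean of its one-sided values. Between the peaks \<open>u\<close> is a combination of \<open>exp x\<close> and \<open>exp (- x)\<close>,
  so that \<open>u\<^sub>x = v\<close> and \<open>v\<^sub>x = u\<close>; at the peak \<open>q\<^sub>i\<close> the slope jumps by \<open>- 2 p\<^sub>i\<close>. The weak formulation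
  is split into a statement about time and one about space.

  In time, \<open>u \<phi>\<^sub>t\<close> is completed to the derivative of \<open>u \<phi>\<close>. For each \<open>x\<close> its integral over time is
  \<open>- u(0, x) \<phi>(0, x)\<close> (\<open>transport_has_integral\<close>), which after Fubini cancels the initial term.

  In space, with \<open>u\<^sub>t = \<Sum>\<^sub>i (p\<^sub>i' + p\<^sub>i q\<^sub>i' sgn (x - q\<^sub>i)) exp (- \<bar>x - q\<^sub>i\<bar>)\<close>, it remains to see that off the peaks
  \<open>((k1 + k2)/3 u\<^sup>3 + k3/2 u\<^sup>2 + p * g)\<^sub>x = - u\<^sub>t + k1/3 v\<^sup>3 - p * f\<close>, where \<open>f\<close> and \<open>g\<close> are the two nonlocal
  sources and \<open>p *\<close> is convolution with \<open>pker\<close> (\<open>peakon_equation_off_peaks\<close>). The function under the \<open>x\<close>-derivative is continuous, so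
  integration by parts against \<open>\<phi>\<close> ignores the finitely many peaks (\<open>peakon_spatial_identity\<close>).

  The equation off the peaks rests on
  \<open>p * f + (p * g)\<^sub>x = 1/2 exp (- x) \<integral>\<^bsub>y \<le> x\<^esub> exp y (f - g) + 1/2 exp x \<integral>\<^bsub>y \<ge> x\<^esub> exp (- y) (f + g)\<close>.
  The integrand \<open>exp y (f - g)\<close> is the derivative of \<open>exp y P(u, v)\<close> for a cubic polynomial \<open>P\<close>. The
  integral up to \<open>x\<close> is therefore \<open>exp x P(u, v)\<close> minus the jumps of \<open>exp y P(u, v)\<close> at the peaks below
  \<open>x\<close> (\<open>exp_primitive_source\<close>), and the dynamical system says exactly that the jump of \<open>P\<close> at \<open>q\<^sub>i\<close> is
  \<open>2 (p\<^sub>i' + p\<^sub>i q\<^sub>i')\<close>. The reflection \<open>x \<mapsto> - x\<close>, which changes \<open>v\<close> to \<open>- v\<close>, gives the other half line. The jumps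
  add up to \<open>- u\<^sub>t\<close>, and the part of \<open>P\<close> that is odd in \<open>v\<close> supplies the local terms.
\<close>

section \<open>Convolution with the peakon kernel\<close>

lemma integral_exp_lower_half_line:
  shows "integrable lborel (\<lambda>y. indicator {..x} y * exp y :: real)"
    and "(LINT y|lborel. indicator {..x} y * exp y) = exp (x::real)"
proof -
  have h: "((\<lambda>y::real. exp (- y)) has_integral exp x) {-x..}"
    using has_integral_exp_minus_to_infinity[of 1 "-x"] by simp
  have "set_integrable lebesgue {-x..} (\<lambda>y. exp (- y) :: real)"
    using h by (intro nonnegative_absolutely_integrable_1) (auto simp: integrable_on_def)
  then have l: "integrable lebesgue (\<lambda>y. indicator {-x..} y * exp (- y) :: real)"
    by (simp add: set_integrable_def)
  have m: "(\<lambda>y. indicator {-x..} y * exp (- y) :: real) \<in> borel_measurable lborel"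
    by measurable
  have 1: "integrable lborel (\<lambda>y. indicator {-x..} y * exp (- y) :: real)"
    using l m by (simp add: integrable_completion)
  then have "set_integrable lborel {-x..} (\<lambda>y. exp (- y))"
    by (simp add: set_integrable_def)
  from set_borel_integral_eq_integral(2)[OF this] integral_unique[OF h]
  have 2: "(LINT y|lborel. indicator {-x..} y * exp (- y)) = exp x"
    by (simp add: set_lebesgue_integral_def)
  have eq: "indicator {-x..} (- y) * exp (- (- y)) = (indicator {..x} y * exp y :: real)" for y
    by (simp add: indicator_def)
  show "integrable lborel (\<lambda>y. indicator {..x} y * exp y :: real)"
    using lborel_integrable_real_affine[OF 1, of "-1" 0] eq by simp
  show "(LINT y|lborel. indicator {..x} y * exp y) = exp (x::real)"
    using lborel_integral_real_affine[of "-1" "\<lambda>y. indicator {-x..} y * exp (- y)" 0] 2 eq by simp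
qed

text \<open>
  Only integrals over lower half lines are introduced: an integral of \<open>exp (- y) * g y\<close> over
  \<open>{x..}\<close> is the value at \<open>- x\<close> for the reflected function.
\<close>
definition exp_primitive :: "(real \<Rightarrow> real) \<Rightarrow> real \<Rightarrow> real" where
  "exp_primitive g x = (LINT y|lborel. indicator {..x} y * (exp y * g y))"

lemma integrable_exp_primitive:
  fixes g :: "real \<Rightarrow> real"
  assumes [measurable]: "g \<in> borel_measurable borel" and bd: "\<And>y. \<bar>g y\<bar> \<le> M"
  shows "integrable lborel (\<lambda>y. indicator {..x} y * (exp y * g y))"
proof (rule Bochner_Integration.integrable_bound)
  show "integrable lborel (\<lambda>y. M * (indicator {..x} y * exp y :: real))"
    using integral_exp_lower_half_line(1) by (rule integrable_mult_right)
  show "AE y in lborel. norm (indicator {..x} y * (exp y * g y))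
           \<le> norm (M * (indicator {..x} y * exp y))"
  proof (rule AE_I2)
    fix y
    have "\<bar>g y\<bar> \<le> \<bar>M\<bar>" using bd[of y] by linarith
    then have "\<bar>g y\<bar> * (indicator {..x} y * exp y) \<le> \<bar>M\<bar> * (indicator {..x} y * exp y)"
      by (rule mult_right_mono) simp
    then show "norm (indicator {..x} y * (exp y * g y)) \<le> norm (M * (indicator {..x} y * exp y))"
      by (simp add: abs_mult algebra_simps)
  qed
qed measurable

lemma exp_primitive_bound:
  fixes g :: "real \<Rightarrow> real"
  assumes m: "g \<in> borel_measurable borel" and bd: "\<And>y. \<bar>g y\<bar> \<le> M"
  shows "\<bar>exp_primitive g x\<bar> \<le> M * exp x"
proof -
  have "norm (exp_primitive g x) \<le> (LINT y|lborel. norm (indicator {..x} y * (exp y * g y)))"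
    unfolding exp_primitive_def by (rule integral_norm_bound)
  also have "\<dots> \<le> (LINT y|lborel. M * (indicator {..x} y * exp y))"
  proof (rule integral_mono)
    show "integrable lborel (\<lambda>y. norm (indicator {..x} y * (exp y * g y)))"
      using integrable_exp_primitive[OF m bd] by (rule integrable_norm)
    show "integrable lborel (\<lambda>y. M * (indicator {..x} y * exp y :: real))"
      using integral_exp_lower_half_line(1) by (rule integrable_mult_right)
    fix y
    have "\<bar>g y\<bar> * (indicator {..x} y * exp y) \<le> M * (indicator {..x} y * exp y)"
      using bd[of y] by (rule mult_right_mono) simp
    then show "norm (indicator {..x} y * (exp y * g y)) \<le> M * (indicator {..x} y * exp y)"
      by (simp add: abs_mult algebra_simps)
  qed
  also have "\<dots> = M * exp x"
    by (simp add: integral_exp_lower_half_line)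
  finally show ?thesis by simp
qed

lemma exp_primitive_diff:
  fixes g :: "real \<Rightarrow> real"
  assumes m[measurable]: "g \<in> borel_measurable borel" and bd: "\<And>y. \<bar>g y\<bar> \<le> M" and "a \<le> x"
  shows "((\<lambda>y. exp y * g y) has_integral (exp_primitive g x - exp_primitive g a)) {a..x}"
proof -
  have int: "integrable lborel (\<lambda>y. indicator {a<..x} y * (exp y * g y))"
    using integrable_mult_indicator[OF _ integrable_exp_primitive[OF m bd, of x], of "{a<..}"]
    by (rule Bochner_Integration.integrable_cong[THEN iffD1, rotated -1])
       (auto simp: indicator_def)
  have "exp_primitive g x - exp_primitive g a
      = (LINT y|lborel. indicator {..x} y * (exp y * g y) - indicator {..a} y * (exp y * g y))"
    unfolding exp_primitive_def
    by (rule Bochner_Integration.integral_diff[symmetric]; rule integrable_exp_primitive[OF m bd])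
  also have "\<dots> = (LINT y|lborel. indicator {a<..x} y * (exp y * g y))"
    using \<open>a \<le> x\<close> by (intro Bochner_Integration.integral_cong) (auto simp: indicator_def)
  finally have "((\<lambda>y. indicator {a<..x} y * (exp y * g y)) has_integral
      (exp_primitive g x - exp_primitive g a)) UNIV"
    using has_integral_integral_lborel[OF int] by simp
  then have "((\<lambda>y. if y \<in> {a<..x} then exp y * g y else 0) has_integral
      (exp_primitive g x - exp_primitive g a)) UNIV"
    by (rule has_integral_eq[rotated]) (auto simp: indicator_def)
  then have "((\<lambda>y. exp y * g y) has_integral (exp_primitive g x - exp_primitive g a)) {a<..x}"
    by (simp only: has_integral_restrict_UNIV)
  moreover have "negligible {y \<in> {a<..x} - {a..x}. exp y * g y \<noteq> 0}"
    by (rule negligible_subset[of "{}"]) auto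
  moreover have "negligible {y \<in> {a..x} - {a<..x}. exp y * g y \<noteq> 0}"
    by (rule negligible_subset[of "{a}"]) auto
  ultimately show ?thesis
    using has_integral_spike_set_eq[of "{a<..x}" "{a..x}" "\<lambda>y. exp y * g y"] by simp
qed

lemma exp_primitive_continuous:
  fixes g :: "real \<Rightarrow> real"
  assumes m: "g \<in> borel_measurable borel" and bd: "\<And>y. \<bar>g y\<bar> \<le> M"
  shows "continuous (at x) (exp_primitive g)"
proof -
  have eq: "exp_primitive g (x-1) + integral {x-1..z} (\<lambda>y. exp y * g y) = exp_primitive g z"
    if "x - 1 \<le> z" for z
    by (subst integral_unique[OF exp_primitive_diff[OF m bd that]]) simp
  have "(\<lambda>y. exp y * g y) integrable_on {x-1..x+1}"
    by (rule has_integral_integrable[OF exp_primitive_diff[OF m bd]]) simp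
  then have "continuous_on {x-1..x+1} (\<lambda>z. integral {x-1..z} (\<lambda>y. exp y * g y))"
    by (rule indefinite_integral_continuous_1)
  then have "continuous_on {x-1..x+1}
      (\<lambda>z. exp_primitive g (x-1) + integral {x-1..z} (\<lambda>y. exp y * g y))"
    by (intro continuous_intros)
  then have "continuous_on {x-1..x+1} (exp_primitive g)"
    by (rule continuous_on_eq) (simp add: eq)
  then show ?thesis
    by (rule continuous_on_interior) auto
qed

lemma exp_primitive_deriv:
  fixes g :: "real \<Rightarrow> real"
  assumes m: "g \<in> borel_measurable borel" and bd: "\<And>y. \<bar>g y\<bar> \<le> M"
    and cont: "continuous (at x) g"
  shows "(exp_primitive g has_real_derivative exp x * g x) (at x)"
proof -
  have "continuous (at x) (\<lambda>y. exp y * g y)"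
    using cont by (intro continuous_intros)
  then have cw: "continuous (at x within {x-1..x+1} - {}) (\<lambda>y. exp y * g y)"
    by (rule continuous_at_imp_continuous_at_within)
  have eq: "exp_primitive g (x-1) + integral {x-1..z} (\<lambda>y. exp y * g y) = exp_primitive g z"
    if "x - 1 \<le> z" for z
    by (subst integral_unique[OF exp_primitive_diff[OF m bd that]]) simp
  have "(\<lambda>y. exp y * g y) integrable_on {x-1..x+1}"
    by (rule has_integral_integrable[OF exp_primitive_diff[OF m bd]]) simp
  then have "((\<lambda>z. integral {x-1..z} (\<lambda>y. exp y * g y)) has_vector_derivative exp x * g x)
      (at x within {x-1..x+1} - {})"
    using cw by (intro integral_has_vector_derivative_continuous_at) auto
  then have "((\<lambda>z. integral {x-1..z} (\<lambda>y. exp y * g y)) has_real_derivative exp x * g x)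
      (at x within {x-1..x+1})"
    by (simp add: has_real_derivative_iff_has_vector_derivative)
  then have "((\<lambda>z. exp_primitive g (x-1) + integral {x-1..z} (\<lambda>y. exp y * g y))
      has_real_derivative 0 + exp x * g x) (at x within {x-1..x+1})"
    by (intro DERIV_add DERIV_const)
  then have "(exp_primitive g has_real_derivative 0 + exp x * g x) (at x within {x-1..x+1})"
    by (rule has_field_derivative_transform_within[where d=1])
       (simp_all add: eq)
  then show ?thesis
    by (simp add: at_within_interior[of x "{x-1..x+1}"])
qed

text \<open>
  The kernel factors as \<open>exp (- x) exp y\<close> for \<open>y < x\<close> and as \<open>exp x exp (- y)\<close> for \<open>y > x\<close>.
\<close>
lemma conv_pker_eq_exp_primitives:
  fixes g :: "real \<Rightarrow> real"
  assumes m[measurable]: "g \<in> borel_measurable borel" and bd: "\<And>y. \<bar>g y\<bar> \<le> M"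
  shows "integrable lborel (\<lambda>y. pker (x - y) * g y)"
    and "(LINT y|lborel. pker (x - y) * g y)
       = 1 / 2 * (exp (- x) * exp_primitive g x + exp x * exp_primitive (\<lambda>y. g (- y)) (- x))"
proof -
  let ?L = "\<lambda>y. 1 / 2 * exp (- x) * (indicator {..x} y * (exp y * g y))"
  let ?R = "\<lambda>y. 1 / 2 * exp x * (indicator {..- x} (- y) * (exp (- y) * g y))"
  have m': "(\<lambda>y. g (- y)) \<in> borel_measurable borel" by measurable
  have iL: "integrable lborel ?L"
    by (intro integrable_mult_right integrable_exp_primitive[OF m bd])
  have iR0: "integrable lborel (\<lambda>y. indicator {..- x} y * (exp y * g (- y)))"
    by (rule integrable_exp_primitive[OF m' bd])
  have iR1: "integrable lborel (\<lambda>y. indicator {..- x} (- y) * (exp (- y) * g y))"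
    using lborel_integrable_real_affine[OF iR0, of "-1" 0] by simp
  have iR: "integrable lborel ?R"
    by (intro integrable_mult_right iR1)
  have ptw: "AE y in lborel. pker (x - y) * g y = ?L y + ?R y"
  proof -
    have "AE y in lborel. y \<noteq> x" by (rule AE_lborel_singleton)
    then show ?thesis
    proof (rule AE_mp, intro AE_I2 impI)
      fix y assume "y \<noteq> x"
      then consider "y < x" | "x < y" by linarith
      then show "pker (x - y) * g y = ?L y + ?R y"
        by cases (simp_all add: pker_def exp_diff exp_minus field_simps)
    qed
  qed
  have mL: "(\<lambda>y. pker (x - y) * g y) \<in> borel_measurable lborel"
    unfolding pker_def by measurable
  show "integrable lborel (\<lambda>y. pker (x - y) * g y)"
    by (rule integrable_cong_AE_imp[OF Bochner_Integration.integrable_add[OF iL iR] mL])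
       (use ptw in eventually_elim, simp)
  have "(LINT y|lborel. pker (x - y) * g y) = (LINT y|lborel. ?L y + ?R y)"
    using mL ptw iL iR by (intro integral_cong_AE) auto
  also have "\<dots> = 1 / 2 * exp (- x) * exp_primitive g x
      + 1 / 2 * exp x * (LINT y|lborel. indicator {..- x} (- y) * (exp (- y) * g y))"
    using iL iR by (simp add: Bochner_Integration.integral_add exp_primitive_def)
  also have "(LINT y|lborel. indicator {..- x} (- y) * (exp (- y) * g y))
      = exp_primitive (\<lambda>y. g (- y)) (- x)"
    unfolding exp_primitive_def
    using lborel_integral_real_affine[of "-1" "\<lambda>y. indicator {..- x} y * (exp y * g (- y))" 0]
    by simp
  finally show "(LINT y|lborel. pker (x - y) * g y)
       = 1 / 2 * (exp (- x) * exp_primitive g x + exp x * exp_primitive (\<lambda>y. g (- y)) (- x))"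
    by (simp add: algebra_simps)
qed

lemma abs_conv_pker_le:
  fixes g :: "real \<Rightarrow> real"
  assumes m[measurable]: "g \<in> borel_measurable borel" and bd: "\<And>y. \<bar>g y\<bar> \<le> M"
  shows "\<bar>LINT y|lborel. pker (x - y) * g y\<bar> \<le> M"
proof -
  have "\<bar>exp_primitive g x\<bar> \<le> M * exp x"
    by (rule exp_primitive_bound[OF m bd])
  then have "exp (- x) * \<bar>exp_primitive g x\<bar> \<le> exp (- x) * (M * exp x)"
    by (rule mult_left_mono) simp
  then have 1: "\<bar>exp (- x) * exp_primitive g x\<bar> \<le> M"
    by (simp add: abs_mult exp_minus field_simps)
  have "\<bar>exp_primitive (\<lambda>y. g (- y)) (- x)\<bar> \<le> M * exp (- x)"
    using bd by (intro exp_primitive_bound) auto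
  then have "exp x * \<bar>exp_primitive (\<lambda>y. g (- y)) (- x)\<bar> \<le> exp x * (M * exp (- x))"
    by (rule mult_left_mono) simp
  then have 2: "\<bar>exp x * exp_primitive (\<lambda>y. g (- y)) (- x)\<bar> \<le> M"
    by (simp add: abs_mult exp_minus field_simps)
  show ?thesis
    unfolding conv_pker_eq_exp_primitives(2)[OF m bd] using 1 2 by (simp add: abs_le_iff)
qed

section \<open>Integrating a derivative across jumps\<close>

lemma eventually_notin_finite:
  fixes S :: "real set"
  assumes "finite S"
  shows "eventually (\<lambda>y. y \<notin> S) (at x within A)"
proof -
  have "eventually (\<lambda>y. \<forall>s\<in>S. y \<noteq> s) (at x within A)"
    using assms by (intro eventually_ball_finite) (auto intro: eventually_neq_at_within)
  then show ?thesis by eventually_elim auto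
qed

text \<open>
  The fundamental theorem of calculus for a function with finitely many jumps. The values
  at the jump points are left arbitrary, since the slope of a multipeakon takes at a peak the mean of its
  one-sided limits and polynomials in the slope then do not take the mean of theirs.
\<close>
lemma has_integral_deriv_with_jumps:
  fixes F D l :: "real \<Rightarrow> real" and q J :: "'i \<Rightarrow> real"
  assumes fin: "finite I" and inj: "inj_on q I"
    and der: "\<And>x. x \<notin> q ` I \<Longrightarrow> (F has_real_derivative D x) (at x)"
    and left: "\<And>i. i \<in> I \<Longrightarrow> (F \<longlongrightarrow> l (q i)) (at_left (q i))"
    and right: "\<And>i. i \<in> I \<Longrightarrow> (F \<longlongrightarrow> l (q i) + J i) (at_right (q i))"
    and "a \<le> b" and ab: "a \<notin> q ` I" "b \<notin> q ` I"
  defines "s \<equiv> (\<lambda>y. \<Sum>i\<in>I. if q i < y then J i else 0)"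
  shows "(D has_integral ((F b - s b) - (F a - s a))) {a..b}"
proof -
  \<comment> \<open>Subtracting the accumulated jumps, and taking left limits at the jump points,
    makes the primitive continuous.\<close>
  define G where "G = (\<lambda>y. (if y \<in> q ` I then l y else F y) - s y)"
  have s_left: "(s \<longlongrightarrow> s x) (at_left x)" for x
    unfolding s_def
  proof (rule tendsto_sum, rule tendsto_eventually)
    fix i assume "i \<in> I"
    show "\<forall>\<^sub>F y in at_left x. (if q i < y then J i else 0) = (if q i < x then J i else 0)"
    proof (cases "q i < x")
      case True
      then have "eventually (\<lambda>y. y \<in> {q i<..<x}) (at_left x)"
        by (rule eventually_at_left_real)
      then show ?thesis by eventually_elim (use True in auto)
    next
      case False
      have "eventually (\<lambda>y. y < x) (at_left x)"
        by (auto simp: eventually_at_filter)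
      then show ?thesis by eventually_elim (use False in auto)
    qed
  qed
  have s_right: "(s \<longlongrightarrow> s x + (\<Sum>i\<in>I. if q i = x then J i else 0)) (at_right x)" for x
    unfolding s_def sum.distrib[symmetric]
  proof (rule tendsto_sum, rule tendsto_eventually)
    fix i assume "i \<in> I"
    show "\<forall>\<^sub>F y in at_right x. (if q i < y then J i else 0)
        = (if q i < x then J i else 0) + (if q i = x then J i else 0)"
    proof (cases "q i \<le> x")
      case True
      have "eventually (\<lambda>y. y > x) (at_right x)"
        by (auto simp: eventually_at_filter)
      then show ?thesis by eventually_elim (use True in auto)
    next
      case False
      then have "eventually (\<lambda>y. y \<in> {x<..<q i}) (at_right x)"
        by (intro eventually_at_right_real) simp
      then show ?thesis by eventually_elim (use False in auto)
    qed
  qed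
  have ev: "eventually (\<lambda>y. F y - s y = G y) (at x within A)" for x A
    using eventually_notin_finite[of "q ` I" x A] fin
    by (auto simp: G_def elim!: eventually_mono)
  have cont: "isCont G x" for x
  proof (cases "x \<in> q ` I")
    case True
    then obtain k where k: "k \<in> I" "x = q k" by auto
    have "(\<Sum>i\<in>I. if q i = x then J i else 0) = (\<Sum>i\<in>I. if i = k then J i else 0)"
      using inj k by (intro sum.cong) (auto dest: inj_onD)
    then have J: "(\<Sum>i\<in>I. if q i = x then J i else 0) = J k"
      using fin k by simp
    have "((\<lambda>y. F y - s y) \<longlongrightarrow> l x - s x) (at_left x)"
      using left[OF k(1)] k(2) by (intro tendsto_diff s_left) auto
    moreover have "((\<lambda>y. F y - s y) \<longlongrightarrow> (l x + J k) - (s x + J k)) (at_right x)"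
      using right[OF k(1)] k(2) s_right[of x] J by (intro tendsto_diff) auto
    ultimately have "(G \<longlongrightarrow> G x) (at_left x)" "(G \<longlongrightarrow> G x) (at_right x)"
      using Lim_transform_eventually[OF _ ev, of "l x - s x" x] True by (auto simp: G_def)
    then show ?thesis
      unfolding isCont_def by (simp add: filterlim_split_at)
  next
    case False
    have F: "(F \<longlongrightarrow> F x) (at x within A)" for A
      using DERIV_isCont[OF der[OF False]] by (auto simp: isCont_def intro: tendsto_within_subset)
    have J: "(\<Sum>i\<in>I. if q i = x then J i else 0) = 0"
      using False by (intro sum.neutral) auto
    have "((\<lambda>y. F y - s y) \<longlongrightarrow> F x - s x) (at_left x)"
      by (intro tendsto_diff s_left F)
    moreover have "((\<lambda>y. F y - s y) \<longlongrightarrow> F x - s x) (at_right x)"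
      using s_right[of x] J by (intro tendsto_diff F) auto
    ultimately have "(G \<longlongrightarrow> G x) (at_left x)" "(G \<longlongrightarrow> G x) (at_right x)"
      using Lim_transform_eventually[OF _ ev, of "F x - s x" x] False by (auto simp: G_def)
    then show ?thesis
      unfolding isCont_def by (simp add: filterlim_split_at)
  qed
  have "(D has_integral (G b - G a)) {a..b}"
  proof (rule fundamental_theorem_of_calculus_interior_strong[where S="q ` I"])
    show "finite (q ` I)" using fin by simp
    show "continuous_on {a..b} G"
      using cont by (auto intro: continuous_at_imp_continuous_on)
    fix x assume "x \<in> {a<..<b} - q ` I"
    then have x: "x \<notin> q ` I" by simp
    have "eventually (\<lambda>y. \<forall>i\<in>I. (q i < y) = (q i < x) \<and> y \<noteq> q i) (nhds x)"
    proof (rule eventually_ball_finite[OF fin], rule ballI)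
      fix i assume "i \<in> I"
      then consider "q i < x" | "x < q i" using x by (metis imageI linorder_neqE)
      then show "eventually (\<lambda>y. (q i < y) = (q i < x) \<and> y \<noteq> q i) (nhds x)"
      proof cases
        case 1
        then have "eventually (\<lambda>y. y \<in> {q i<..}) (nhds x)"
          by (intro eventually_nhds_in_open) auto
        then show ?thesis by eventually_elim (use 1 in auto)
      next
        case 2
        then have "eventually (\<lambda>y. y \<in> {..<q i}) (nhds x)"
          by (intro eventually_nhds_in_open) auto
        then show ?thesis by eventually_elim (use 2 in auto)
      qed
    qed
    then have "eventually (\<lambda>y. G y = F y - s x) (nhds x)"
    proof eventually_elim
      case (elim y)
      then have "s y = s x"
        unfolding s_def by (intro sum.cong) auto
      with elim show ?case by (auto simp: G_def)
    qed
    then have "(G has_real_derivative D x) (at x) \<longleftrightarrow>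
        ((\<lambda>y. F y - s x) has_real_derivative D x) (at x)"
      by (intro DERIV_cong_ev) auto
    moreover have "((\<lambda>y. F y - s x) has_real_derivative D x) (at x)"
      using DERIV_diff[OF der[OF x] DERIV_const] by simp
    ultimately show "(G has_vector_derivative D x) (at x)"
      by (simp add: has_real_derivative_iff_has_vector_derivative)
  qed fact
  then show ?thesis
    using ab by (simp add: G_def)
qed

section \<open>Superpositions of peakons and their slopes\<close>

definition peakon_sum :: "'i set \<Rightarrow> ('i \<Rightarrow> real) \<Rightarrow> ('i \<Rightarrow> real) \<Rightarrow> real \<Rightarrow> real" where
  "peakon_sum I p q x = (\<Sum>i\<in>I. p i * exp (- \<bar>x - q i\<bar>))"

definition peakon_slope :: "'i set \<Rightarrow> ('i \<Rightarrow> real) \<Rightarrow> ('i \<Rightarrow> real) \<Rightarrow> real \<Rightarrow> real" where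
  "peakon_slope I p q x = - (\<Sum>i\<in>I. p i * sgn (x - q i) * exp (- \<bar>x - q i\<bar>))"

lemma peakon_sum_reflect: "peakon_sum I p (\<lambda>i. - q i) (- x) = peakon_sum I p q x"
proof -
  have "\<bar>- x - - q i\<bar> = \<bar>x - q i\<bar>" for i by simp
  then show ?thesis by (simp only: peakon_sum_def)
qed

lemma peakon_slope_reflect: "peakon_slope I p (\<lambda>i. - q i) (- x) = - peakon_slope I p q x"
proof -
  have "\<bar>- x - - q i\<bar> = \<bar>x - q i\<bar>" "sgn (- x - - q i) = - sgn (x - q i)" for i
    by (simp_all add: sgn_if)
  then show ?thesis by (simp only: peakon_slope_def sum_negf mult_minus_left mult_minus_right)
qed

lemma abs_peakon_sum_le: "\<bar>peakon_sum I p q x\<bar> \<le> (\<Sum>i\<in>I. \<bar>p i\<bar>)"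
  unfolding peakon_sum_def
  by (rule order_trans[OF sum_abs])
     (auto intro!: sum_mono mult_left_le simp: abs_mult)

lemma abs_peakon_slope_le: "\<bar>peakon_slope I p q x\<bar> \<le> (\<Sum>i\<in>I. \<bar>p i\<bar>)"
  unfolding peakon_slope_def abs_minus_cancel
  by (rule order_trans[OF sum_abs])
     (auto intro!: sum_mono mult_left_le simp: abs_mult abs_sgn_eq)

lemma peakon_sum_measurable [measurable]: "peakon_sum I p q \<in> borel_measurable borel"
  unfolding peakon_sum_def[abs_def] by measurable

lemma peakon_slope_measurable [measurable]: "peakon_slope I p q \<in> borel_measurable borel"
  unfolding peakon_slope_def[abs_def] by measurable

lemma isCont_peakon_sum: "isCont (peakon_sum I p q) x"
  unfolding peakon_sum_def[abs_def] by (intro continuous_intros)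

lemma peakon_profile_deriv:
  fixes x q :: real
  assumes "x \<noteq> q"
  shows "((\<lambda>y. exp (- \<bar>y - q\<bar>)) has_real_derivative - (sgn (x - q) * exp (- \<bar>x - q\<bar>))) (at x)"
    and "((\<lambda>y. sgn (y - q) * exp (- \<bar>y - q\<bar>)) has_real_derivative - exp (- \<bar>x - q\<bar>)) (at x)"
proof -
  define s where "s = sgn (x - q)"
  have ss: "s * s = 1" and xs: "\<bar>x - q\<bar> = s * (x - q)"
    using assms by (auto simp: s_def sgn_if)
  have "eventually (\<lambda>y. sgn (y - q) = s) (nhds x)"
  proof (cases "x > q")
    case True
    then have "eventually (\<lambda>y. y \<in> {q<..}) (nhds x)"
      by (intro eventually_nhds_in_open) auto
    then show ?thesis by eventually_elim (use True in \<open>auto simp: s_def\<close>)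
  next
    case False
    then have "eventually (\<lambda>y. y \<in> {..<q}) (nhds x)"
      using assms by (intro eventually_nhds_in_open) auto
    then show ?thesis by eventually_elim (use False assms in \<open>auto simp: s_def\<close>)
  qed
  then have ev1: "eventually (\<lambda>y. exp (- \<bar>y - q\<bar>) = exp (- (s * (y - q)))) (nhds x)"
    and ev2: "eventually (\<lambda>y. sgn (y - q) * exp (- \<bar>y - q\<bar>) = s * exp (- (s * (y - q)))) (nhds x)"
    by (eventually_elim; use ss in \<open>auto simp: abs_sgn mult.commute\<close>)+
  have "((\<lambda>y. exp (- (s * (y - q)))) has_real_derivative - (s * exp (- (s * (x - q))))) (at x)"
    by (auto intro!: derivative_eq_intros)
  then show "((\<lambda>y. exp (- \<bar>y - q\<bar>)) has_real_derivative - (sgn (x - q) * exp (- \<bar>x - q\<bar>))) (at x)"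
    using DERIV_cong_ev[OF refl ev1 refl] xs by (simp add: s_def)
  have "((\<lambda>y. s * exp (- (s * (y - q)))) has_real_derivative - (s * s * exp (- (s * (x - q))))) (at x)"
    by (auto intro!: derivative_eq_intros)
  then show "((\<lambda>y. sgn (y - q) * exp (- \<bar>y - q\<bar>)) has_real_derivative - exp (- \<bar>x - q\<bar>)) (at x)"
    using DERIV_cong_ev[OF refl ev2 refl] xs ss by simp
qed

lemma peakon_sum_deriv:
  assumes "x \<notin> q ` I"
  shows "(peakon_sum I p q has_real_derivative peakon_slope I p q x) (at x)"
proof -
  have "((\<lambda>y. \<Sum>i\<in>I. p i * exp (- \<bar>y - q i\<bar>)) has_real_derivative
      (\<Sum>i\<in>I. p i * - (sgn (x - q i) * exp (- \<bar>x - q i\<bar>)))) (at x)"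
    using assms by (intro DERIV_sum DERIV_cmult peakon_profile_deriv) auto
  then show ?thesis
    by (simp add: peakon_sum_def[abs_def] peakon_slope_def sum_negf mult.assoc)
qed

lemma peakon_slope_deriv:
  assumes "x \<notin> q ` I"
  shows "(peakon_slope I p q has_real_derivative peakon_sum I p q x) (at x)"
proof -
  have "((\<lambda>y. \<Sum>i\<in>I. - p i * (sgn (y - q i) * exp (- \<bar>y - q i\<bar>))) has_real_derivative
      (\<Sum>i\<in>I. - p i * - exp (- \<bar>x - q i\<bar>))) (at x)"
    using assms by (intro DERIV_sum DERIV_cmult peakon_profile_deriv) auto
  then show ?thesis
    by (simp add: peakon_sum_def peakon_slope_def[abs_def] sum_negf mult.assoc)
qed

text \<open>
  At \<open>q k\<close> the \<open>k\<close>-th term has the value 0 and the one-sided limits \<open>p k\<close> and \<open>- p k\<close>; the other terms are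
  continuous there because the positions are distinct.
\<close>
lemma peakon_slope_one_sided:
  assumes fin: "finite I" and inj: "inj_on q I" and k: "k \<in> I"
  shows "(peakon_slope I p q \<longlongrightarrow> peakon_slope I p q (q k) + p k) (at_left (q k))"
    and "(peakon_slope I p q \<longlongrightarrow> peakon_slope I p q (q k) - p k) (at_right (q k))"
proof -
  define A where "A = (\<lambda>i y. - p i * sgn (y - q i) * exp (- \<bar>y - q i\<bar>))"
  have sl: "peakon_slope I p q = (\<lambda>y. \<Sum>i\<in>I. A i y)"
    by (simp add: peakon_slope_def[abs_def] A_def sum_negf)
  have off: "(A i \<longlongrightarrow> A i (q k)) (at (q k) within S)" if "i \<in> I" "i \<noteq> k" for i S
    unfolding A_def using that k inj by (intro tendsto_intros) (auto dest: inj_onD)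
  have e: "((\<lambda>y. c * exp (- \<bar>y - q k\<bar>)) \<longlongrightarrow> c * exp (- \<bar>q k - q k\<bar>)) (at (q k) within S)"
    for c S by (intro tendsto_intros)
  have evl: "eventually (\<lambda>y. p k * exp (- \<bar>y - q k\<bar>) = A k y) (at_left (q k))"
    by (auto simp: eventually_at_filter A_def)
  have evr: "eventually (\<lambda>y. - p k * exp (- \<bar>y - q k\<bar>) = A k y) (at_right (q k))"
    by (auto simp: eventually_at_filter A_def)
  have Ak: "A k (q k) = 0" by (simp add: A_def)
  have l: "(A i \<longlongrightarrow> A i (q k) + (if i = k then p k else 0)) (at_left (q k))" if "i \<in> I" for i
    using off[OF that] Lim_transform_eventually[OF e evl] Ak by auto
  have r: "(A i \<longlongrightarrow> A i (q k) + (if i = k then - p k else 0)) (at_right (q k))" if "i \<in> I" for i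
    using off[OF that] Lim_transform_eventually[OF e evr] Ak by auto
  have "((\<lambda>y. \<Sum>i\<in>I. A i y) \<longlongrightarrow> (\<Sum>i\<in>I. A i (q k) + (if i = k then p k else 0))) (at_left (q k))"
    by (intro tendsto_sum l)
  then show "(peakon_slope I p q \<longlongrightarrow> peakon_slope I p q (q k) + p k) (at_left (q k))"
    unfolding sl using fin k by (simp add: sum.distrib)
  have "((\<lambda>y. \<Sum>i\<in>I. A i y) \<longlongrightarrow> (\<Sum>i\<in>I. A i (q k) + (if i = k then - p k else 0))) (at_right (q k))"
    by (intro tendsto_sum r)
  then show "(peakon_slope I p q \<longlongrightarrow> peakon_slope I p q (q k) - p k) (at_right (q k))"
    unfolding sl using fin k by (simp add: sum.distrib)
qed

section \<open>The nonlocal sources and their half-line integrals\<close>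

lemma continuous_imp_bounded_on_square:
  fixes F :: "real \<Rightarrow> real \<Rightarrow> real"
  assumes "continuous_on UNIV (\<lambda>(u, v). F u v)"
  obtains M where "\<And>u v. \<bar>u\<bar> \<le> C \<Longrightarrow> \<bar>v\<bar> \<le> C \<Longrightarrow> \<bar>F u v\<bar> \<le> M"
proof -
  have "compact ((\<lambda>(u, v). F u v) ` ({-C..C} \<times> {-C..C}))"
    using assms by (intro compact_continuous_image compact_Times) (auto intro: continuous_on_subset)
  then obtain M where M: "\<forall>y\<in>(\<lambda>(u, v). F u v) ` ({-C..C} \<times> {-C..C}). norm y \<le> M"
    using compact_imp_bounded bounded_iff by metis
  show thesis
  proof (rule that[of M])
    fix u v :: real assume "\<bar>u\<bar> \<le> C" "\<bar>v\<bar> \<le> C"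
    then have "(u, v) \<in> {-C..C} \<times> {-C..C}" by auto
    with M show "\<bar>F u v\<bar> \<le> M" by fastforce
  qed
qed

lemma peakon_composite_bounded:
  fixes F :: "real \<Rightarrow> real \<Rightarrow> real"
  assumes "continuous_on UNIV (\<lambda>(u, v). F u v)"
  obtains M where "\<And>x. \<bar>F (peakon_sum I p q x) (peakon_slope I p q x)\<bar> \<le> M"
  using continuous_imp_bounded_on_square[OF assms] abs_peakon_sum_le abs_peakon_slope_le by metis

text \<open>
  The densities of \<open>nonloc1\<close> and \<open>nonloc2\<close> as functions of two numbers, so that bounds and continuity are
  statements about polynomials and the product rule can be applied to them.
\<close>
definition source1 :: "real \<Rightarrow> real \<Rightarrow> real \<Rightarrow> real" where
  "source1 k1 k2 v = (k1 / 3 + k2 / 2) * v ^ 3"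

definition source2 :: "real \<Rightarrow> real \<Rightarrow> real \<Rightarrow> real \<Rightarrow> real \<Rightarrow> real" where
  "source2 k1 k2 k3 u v =
     (2 * k1 / 3 + k2) * u ^ 3 + (k1 + 3 * k2 / 2) * u * v ^ 2 + k3 * u ^ 2 + k3 / 2 * v ^ 2"

text \<open>
  A polynomial \<open>P\<close> with \<open>P + v P\<^sub>u + u P\<^sub>v = source1 - source2\<close>. Such a \<open>P\<close> is not
  unique: multiples of \<open>(u - v) (u\<^sup>2 - v\<^sup>2)\<close> may be added, because \<open>exp x (u - v)\<close> and \<open>u\<^sup>2 - v\<^sup>2\<close> are constant
  between the peaks. This choice has the odd part \<open>k1/3 v\<^sup>3 - (k1 + k2) u\<^sup>2 v - k3 u v\<close> in \<open>v\<close>, which are the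
  local terms of the equation.
\<close>
definition source_primitive :: "real \<Rightarrow> real \<Rightarrow> real \<Rightarrow> real \<Rightarrow> real \<Rightarrow> real" where
  "source_primitive k1 k2 k3 u v =
     k1 / 3 * u ^ 3 - (k1 + k2) * u ^ 2 * v + k2 / 2 * u * v ^ 2 + k1 / 3 * v ^ 3
     + k3 * (v ^ 2 / 2 - u * v)"

text \<open>
  The jump of \<open>source_primitive\<close> where \<open>v\<close> falls from \<open>v + a\<close> to \<open>v - a\<close>, arranged so that for \<open>a = p\<^sub>i\<close>
  the right-hand sides of the dynamical system for \<open>q\<^sub>i\<close> and \<open>p\<^sub>i\<close> can be read off.
\<close>
definition source_jump :: "real \<Rightarrow> real \<Rightarrow> real \<Rightarrow> real \<Rightarrow> real \<Rightarrow> real \<Rightarrow> real" where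
  "source_jump k1 k2 k3 a u v =
     2 * a * (- (k1 / 3) * a ^ 2 - k1 * v ^ 2 + (k1 + k2) * u ^ 2 + k3 * u - v * (k2 * u + k3))"

lemma source_jump_eq:
  "source_primitive k1 k2 k3 u (v - a) - source_primitive k1 k2 k3 u (v + a)
     = source_jump k1 k2 k3 a u v"
  by (simp add: source_primitive_def source_jump_def algebra_simps power2_eq_square power3_eq_cube
      add_divide_distrib diff_divide_distrib)

lemma source_primitive_deriv:
  fixes p q :: "'i \<Rightarrow> real"
  assumes "x \<notin> q ` I"
  defines "u \<equiv> peakon_sum I p q" and "v \<equiv> peakon_slope I p q"
  shows "((\<lambda>y. exp y * source_primitive k1 k2 k3 (u y) (v y)) has_real_derivative
           exp x * (source1 k1 k2 (v x) - source2 k1 k2 k3 (u x) (v x))) (at x)"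
proof -
  have u: "(u has_real_derivative v x) (at x)" and v: "(v has_real_derivative u x) (at x)"
    using assms(1) peakon_sum_deriv peakon_slope_deriv by (auto simp: u_def v_def)
  show ?thesis
    unfolding source_primitive_def source1_def source2_def
    by (auto intro!: derivative_eq_intros u v simp: field_simps power2_eq_square power3_eq_cube)
qed

lemma borel_measurable_continuous_comp2:
  fixes F :: "real \<Rightarrow> real \<Rightarrow> real"
  assumes "continuous_on UNIV (\<lambda>(u, v). F u v)"
    and [measurable]: "f \<in> borel_measurable M" "g \<in> borel_measurable M"
  shows "(\<lambda>x. F (f x) (g x)) \<in> borel_measurable M"
proof -
  have [measurable]: "(\<lambda>(u, v). F u v) \<in> borel_measurable borel"
    using assms(1) by (rule borel_measurable_continuous_onI)
  have "(\<lambda>x. (\<lambda>(u, v). F u v) (f x, g x)) \<in> borel_measurable M"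
    by measurable
  then show ?thesis by simp
qed

text \<open>
  Both sides have the same increments, by the theorem on jumps, and both tend to 0 at \<open>- \<infinity>\<close>: the sources
  and \<open>source_primitive\<close> are bounded, and below all peaks the sum is empty.
\<close>
lemma exp_primitive_source:
  fixes p q :: "'i \<Rightarrow> real"
  assumes fin: "finite I" and inj: "inj_on q I" and x: "x \<notin> q ` I"
  defines "u \<equiv> peakon_sum I p q" and "v \<equiv> peakon_slope I p q"
  shows "exp_primitive (\<lambda>y. source1 k1 k2 (v y) - source2 k1 k2 k3 (u y) (v y)) x
    = exp x * source_primitive k1 k2 k3 (u x) (v x)
      - (\<Sum>i\<in>I. if q i < x then exp (q i) * source_jump k1 k2 k3 (p i) (u (q i)) (v (q i)) else 0)"
proof -
  define h where "h = (\<lambda>y. source1 k1 k2 (v y) - source2 k1 k2 k3 (u y) (v y))"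
  define F where "F = (\<lambda>y. exp y * source_primitive k1 k2 k3 (u y) (v y))"
  define J where "J = (\<lambda>i. exp (q i) * source_jump k1 k2 k3 (p i) (u (q i)) (v (q i)))"
  define s where "s = (\<lambda>y. \<Sum>i\<in>I. if q i < y then J i else 0)"
  define A where "A = {a. a \<notin> q ` I \<and> a \<le> x}"
  have ch: "continuous_on UNIV (\<lambda>(u, v). source1 k1 k2 v - source2 k1 k2 k3 u v)"
    unfolding source1_def source2_def split_def by (intro continuous_intros)
  have cP: "continuous_on UNIV (\<lambda>(u, v). source_primitive k1 k2 k3 u v)"
    unfolding source_primitive_def split_def by (intro continuous_intros) auto
  obtain M where M: "\<And>y. \<bar>h y\<bar> \<le> M"
    using peakon_composite_bounded[OF ch, where I=I and p=p and q=q] unfolding h_def u_def v_def by blast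
  obtain M' where M': "\<And>y. \<bar>source_primitive k1 k2 k3 (u y) (v y)\<bar> \<le> M'"
    using peakon_composite_bounded[OF cP, where I=I and p=p and q=q] unfolding u_def v_def by blast
  have mh: "h \<in> borel_measurable borel"
    unfolding h_def u_def v_def
    using borel_measurable_continuous_comp2[OF ch, of "peakon_sum I p q" borel "peakon_slope I p q"]
    by simp
  have sp: "((\<lambda>y. source_primitive k1 k2 k3 (f y) (g y)) \<longlongrightarrow> source_primitive k1 k2 k3 a b) X"
    if "(f \<longlongrightarrow> a) X" "(g \<longlongrightarrow> b) X" for f g a b and X :: "real filter"
    unfolding source_primitive_def using that by (intro tendsto_intros) auto
  have ulim: "(u \<longlongrightarrow> u y) (at y within S)" for y S
    using isCont_peakon_sum[where I=I and p=p and q=q and x=y] by (auto simp: u_def isCont_def intro: tendsto_within_subset)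
  \<comment> \<open>The left limit of \<open>F\<close> at each point; at a peak the slope is larger there by the amplitude.\<close>
  define l where "l = (\<lambda>y. exp y * source_primitive k1 k2 k3 (u y)
      (v y + (if y \<in> q ` I then p (the_inv_into I q y) else 0)))"
  have l: "l (q i) = exp (q i) * source_primitive k1 k2 k3 (u (q i)) (v (q i) + p i)" if "i \<in> I" for i
    using that inj by (simp add: l_def the_inv_into_f_f)
  have ftc: "(h' has_integral ((F x - s x) - (F a - s a))) {a..x}"
    if a: "a \<notin> q ` I" "a \<le> x" and h': "h' = (\<lambda>y. exp y * h y)" for a h'
    unfolding s_def
  proof (rule has_integral_deriv_with_jumps[where l = l, OF fin inj _ _ _ a(2) a(1) x])
    show "(F has_real_derivative h' y) (at y)" if "y \<notin> q ` I" for y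
      using source_primitive_deriv[OF that, where p=p] by (simp add: F_def h_def h' u_def v_def)
    fix i assume i: "i \<in> I"
    show "(F \<longlongrightarrow> l (q i)) (at_left (q i))"
      unfolding F_def l[OF i] using peakon_slope_one_sided(1)[OF fin inj i, of p]
      by (intro tendsto_mult tendsto_exp tendsto_ident_at sp ulim) (simp add: v_def)
    have "(F \<longlongrightarrow> exp (q i) * source_primitive k1 k2 k3 (u (q i)) (v (q i) - p i)) (at_right (q i))"
      unfolding F_def using peakon_slope_one_sided(2)[OF fin inj i, of p]
      by (intro tendsto_mult tendsto_exp tendsto_ident_at sp ulim) (simp add: v_def)
    also have "exp (q i) * source_primitive k1 k2 k3 (u (q i)) (v (q i) - p i) = l (q i) + J i"
      unfolding l[OF i] J_def source_jump_eq[symmetric] by (simp add: algebra_simps)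
    finally show "(F \<longlongrightarrow> l (q i) + J i) (at_right (q i))" .
  qed
  have eq: "exp_primitive h x - (F x - s x) = exp_primitive h a - (F a - s a)"
    if "a \<notin> q ` I" "a \<le> x" for a
    using has_integral_unique[OF exp_primitive_diff[OF mh M that(2)] ftc[OF that refl]] by simp
  \<comment> \<open>Below \<open>b\<close> there are no peaks.\<close>
  define b where "b = Min (insert x (q ` I))"
  have b: "eventually (\<lambda>a. a < b) at_bot"
    by (rule eventually_gt_at_bot) 
  have far: "a \<notin> q ` I" "a \<le> x" "s a = 0" if "a < b" for a
  proof -
    have *: "a < x" "\<forall>i\<in>I. a < q i"
      using that fin by (auto simp: b_def)
    then show "a \<notin> q ` I" "a \<le> x" "s a = 0"
      by (auto simp: s_def intro!: sum.neutral)
  qed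
  have "((\<lambda>a::real. exp_primitive h x - (F x - s x)) \<longlongrightarrow> 0) at_bot"
  proof (rule Lim_null_comparison)
    show "\<forall>\<^sub>F a in at_bot. norm (exp_primitive h x - (F x - s x)) \<le> (M + M') * exp a"
      using b
    proof eventually_elim
      case (elim a)
      have "\<bar>exp_primitive h a\<bar> \<le> M * exp a"
        by (rule exp_primitive_bound[OF mh M])
      moreover have "\<bar>F a\<bar> \<le> M' * exp a"
        using mult_right_mono[OF M'[of a], of "exp a"] by (simp add: F_def abs_mult mult.commute)
      ultimately show ?case
        unfolding eq[OF far(1,2)[OF elim]] using far(3)[OF elim] by (simp add: algebra_simps)
    qed
    show "((\<lambda>a. (M + M') * exp a) \<longlongrightarrow> 0) at_bot"
      by (intro tendsto_mult_right_zero exp_at_bot)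
  qed
  then have "exp_primitive h x - (F x - s x) = 0"
    by (simp add: tendsto_const_iff)
  then show ?thesis
    unfolding h_def F_def s_def J_def by (rule eq_iff_diff_eq_0[THEN iffD2])
qed

lemma exp_primitive_add:
  fixes f g :: "real \<Rightarrow> real"
  assumes "f \<in> borel_measurable borel" "\<And>y. \<bar>f y\<bar> \<le> M"
    and "g \<in> borel_measurable borel" "\<And>y. \<bar>g y\<bar> \<le> M'"
  shows "exp_primitive (\<lambda>y. f y + g y) x = exp_primitive f x + exp_primitive g x"
  unfolding exp_primitive_def distrib_left
  by (intro Bochner_Integration.integral_add integrable_exp_primitive[OF assms(1,2)]
        integrable_exp_primitive[OF assms(3,4)])

lemma exp_primitive_minus: "exp_primitive (\<lambda>y. - f y) x = - exp_primitive f x"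
  unfolding exp_primitive_def by simp

lemma conv_lborel:
  assumes [measurable]: "g \<in> borel_measurable borel"
  shows "conv pker g x = (LINT y|lborel. pker (x - y) * g y)"
  unfolding conv_def pker_def by (rule integral_completion) measurable

text \<open>
  Differentiating the two half-line integrals produces \<open>g x\<close> with opposite signs, so no local term
  is left.
\<close>
lemma conv_pker_deriv:
  fixes g :: "real \<Rightarrow> real"
  assumes m[measurable]: "g \<in> borel_measurable borel" and bd: "\<And>y. \<bar>g y\<bar> \<le> M"
    and cont: "isCont g x"
  shows "(conv pker g has_real_derivative
     1 / 2 * (exp x * exp_primitive (\<lambda>y. g (- y)) (- x) - exp (- x) * exp_primitive g x)) (at x)"
proof -
  have m': "(\<lambda>y. g (- y)) \<in> borel_measurable borel" by measurable
  have E1: "(exp_primitive g has_real_derivative exp x * g x) (at x)"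
    by (rule exp_primitive_deriv[OF m bd cont])
  have "isCont (\<lambda>y. g (- y)) (- x)"
    by (rule isCont_o2[where f = uminus and g = g]) (use cont in simp_all)
  then have "(exp_primitive (\<lambda>y. g (- y)) has_real_derivative exp (- x) * g (- (- x))) (at (- x))"
    by (rule exp_primitive_deriv[OF m' bd])
  then have E2: "((\<lambda>y. exp_primitive (\<lambda>y. g (- y)) (- y)) has_real_derivative
      exp (- x) * g (- (- x)) * (- 1)) (at x)"
    by (rule DERIV_chain2) (auto intro!: derivative_eq_intros)
  have "((\<lambda>x. 1 / 2 * (exp (- x) * exp_primitive g x + exp x * exp_primitive (\<lambda>y. g (- y)) (- x)))
      has_real_derivative
     1 / 2 * (exp x * exp_primitive (\<lambda>y. g (- y)) (- x) - exp (- x) * exp_primitive g x)) (at x)"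
    by (auto intro!: derivative_eq_intros E1 E2 simp: field_simps exp_minus)
  moreover have "conv pker g
      = (\<lambda>x. 1 / 2 * (exp (- x) * exp_primitive g x + exp x * exp_primitive (\<lambda>y. g (- y)) (- x)))"
    using conv_pker_eq_exp_primitives(2)[OF m bd] conv_lborel[OF m] by (intro ext) simp
  ultimately show ?thesis by simp
qed

lemma isCont_conv_pker:
  fixes g :: "real \<Rightarrow> real"
  assumes m[measurable]: "g \<in> borel_measurable borel" and bd: "\<And>y. \<bar>g y\<bar> \<le> M"
  shows "isCont (conv pker g) x"
proof -
  have m': "(\<lambda>y. g (- y)) \<in> borel_measurable borel" by measurable
  have c1: "isCont (exp_primitive g) x"
    by (rule exp_primitive_continuous[OF m bd])
  have c2: "isCont (\<lambda>x. exp_primitive (\<lambda>y. g (- y)) (- x)) x"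
    by (rule isCont_o2[where f = uminus]) (auto intro: exp_primitive_continuous[OF m' bd])
  have "isCont (\<lambda>x. 1 / 2 * (exp (- x) * exp_primitive g x + exp x * exp_primitive (\<lambda>y. g (- y)) (- x))) x"
    by (intro continuous_intros c1 c2)
  moreover have "conv pker g
      = (\<lambda>x. 1 / 2 * (exp (- x) * exp_primitive g x + exp x * exp_primitive (\<lambda>y. g (- y)) (- x)))"
    using conv_pker_eq_exp_primitives(2)[OF m bd] conv_lborel[OF m] by (intro ext) simp
  ultimately show ?thesis by simp
qed

section \<open>The equation at a fixed time\<close>

text \<open>
  The dynamical system enters only through the values of \<open>source_jump\<close> at the peaks, which are
  \<open>2 (pd i + p i * qd i)\<close> seen from below and, after reflection, \<open>- 2 (pd i - p i * qd i)\<close> seen from above. The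
  weights \<open>exp (q i - x)\<close> and \<open>exp (x - q i)\<close> of the peaks below and above \<open>x\<close> then merge into
  \<open>exp (- \<bar>x - q i\<bar>)\<close>, with the sign of \<open>x - q i\<close> in front of \<open>qd i\<close>.
\<close>
lemma peakon_equation_off_peaks:
  fixes p q pd qd :: "'i \<Rightarrow> real"
  assumes fin: "finite I" and inj: "inj_on q I" and x: "x \<notin> q ` I"
  defines "u \<equiv> peakon_sum I p q" and "v \<equiv> peakon_slope I p q"
  assumes pd: "\<And>i. i \<in> I \<Longrightarrow> pd i = - p i * v (q i) * (k2 * u (q i) + k3)"
    and qd: "\<And>i. i \<in> I \<Longrightarrow> qd i = - (k1 / 3) * (p i)\<^sup>2 - k1 * (v (q i))\<^sup>2
                + (k1 + k2) * (u (q i))\<^sup>2 + k3 * u (q i)"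
  defines "ut \<equiv> (\<lambda>x. \<Sum>i\<in>I. (pd i + p i * qd i * sgn (x - q i)) * exp (- \<bar>x - q i\<bar>))"
  defines "P1 \<equiv> conv pker (\<lambda>y. source1 k1 k2 (v y))"
    and "P2 \<equiv> conv pker (\<lambda>y. source2 k1 k2 k3 (u y) (v y))"
  shows "((\<lambda>x. (k1 + k2) / 3 * u x ^ 3 + k3 / 2 * u x ^ 2 + P2 x) has_real_derivative
           - ut x + k1 / 3 * v x ^ 3 - P1 x) (at x)"
proof -
  define f where "f = (\<lambda>y. source1 k1 k2 (v y))"
  define g where "g = (\<lambda>y. source2 k1 k2 k3 (u y) (v y))"
  have cf: "continuous_on UNIV (\<lambda>(u, v). source1 k1 k2 v)"
    unfolding source1_def split_def by (intro continuous_intros)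
  have cg: "continuous_on UNIV (\<lambda>(u, v). source2 k1 k2 k3 u v)"
    unfolding source2_def split_def by (intro continuous_intros)
  obtain M where Mf: "\<And>y. \<bar>f y\<bar> \<le> M"
    using peakon_composite_bounded[OF cf, where I=I and p=p and q=q] unfolding f_def v_def by blast
  obtain M' where Mg: "\<And>y. \<bar>g y\<bar> \<le> M'"
    using peakon_composite_bounded[OF cg, where I=I and p=p and q=q] unfolding g_def u_def v_def by blast
  have mf[measurable]: "f \<in> borel_measurable borel"
    unfolding f_def v_def source1_def by measurable
  have mg[measurable]: "g \<in> borel_measurable borel"
    unfolding g_def u_def v_def source2_def by measurable
  have u: "(u has_real_derivative v x) (at x)" and v: "(v has_real_derivative u x) (at x)"
    using x peakon_sum_deriv peakon_slope_deriv by (auto simp: u_def v_def)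
  have "isCont g x"
    unfolding g_def source2_def using DERIV_isCont[OF u] DERIV_isCont[OF v]
    by (intro continuous_intros)
  from conv_pker_deriv[OF mg Mg this]
  have dP2: "(P2 has_real_derivative
     1 / 2 * (exp x * exp_primitive (\<lambda>y. g (- y)) (- x) - exp (- x) * exp_primitive g x)) (at x)"
    (is "(_ has_real_derivative ?D) _")
    by (simp add: P2_def g_def)
  have P1: "P1 x = 1 / 2 * (exp (- x) * exp_primitive f x + exp x * exp_primitive (\<lambda>y. f (- y)) (- x))"
    using conv_pker_eq_exp_primitives(2)[OF mf Mf, of x] conv_lborel[OF mf, of x] by (simp add: P1_def f_def)
  \<comment> \<open>\<open>lower\<close> collects the peaks below \<open>x\<close>, \<open>upper\<close> those above.\<close>
  have lower: "exp_primitive f x - exp_primitive g x = exp x * source_primitive k1 k2 k3 (u x) (v x)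
      - (\<Sum>i\<in>I. if q i < x then exp (q i) * source_jump k1 k2 k3 (p i) (u (q i)) (v (q i)) else 0)"
  proof -
    have "exp_primitive f x - exp_primitive g x = exp_primitive (\<lambda>y. f y + - g y) x"
      using exp_primitive_add[OF mf Mf, of "\<lambda>y. - g y" M' x] Mg by (simp add: exp_primitive_minus)
    then show ?thesis
      using exp_primitive_source[OF fin inj x, of k1 k2 p k3, folded u_def v_def]
      by (simp add: f_def g_def)
  qed
  have upper: "exp_primitive (\<lambda>y. f (- y)) (- x) + exp_primitive (\<lambda>y. g (- y)) (- x)
      = - (exp (- x) * source_primitive k1 k2 k3 (u x) (- v x))
        + (\<Sum>i\<in>I. if x < q i then exp (- q i) * source_jump k1 k2 k3 (p i) (u (q i)) (- v (q i)) else 0)"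
  proof -
    let ?q = "\<lambda>i. - q i"
    let ?u = "peakon_sum I p ?q" and ?v = "peakon_slope I p ?q"
    have r: "u (- y) = ?u y" "v (- y) = - ?v y" for y
      using peakon_sum_reflect[of I p q "- y"] peakon_slope_reflect[of I p q "- y"]
      by (simp_all add: u_def v_def)
    have r': "?u (- y) = u y" "?v (- y) = - v y" for y
      by (simp_all add: peakon_sum_reflect peakon_slope_reflect u_def v_def)
    have "inj_on ?q I" "- x \<notin> ?q ` I"
      using inj x by (auto simp: inj_on_def)
    note E = exp_primitive_source[OF fin this, of k1 k2 p k3, unfolded r' neg_less_iff_less]
    have "exp_primitive (\<lambda>y. f (- y)) (- x) + exp_primitive (\<lambda>y. g (- y)) (- x)
        = exp_primitive (\<lambda>y. f (- y) + g (- y)) (- x)"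
      using exp_primitive_add[of "\<lambda>y. f (- y)" M "\<lambda>y. g (- y)" M' "- x"] Mf Mg by simp
    also have "(\<lambda>y. f (- y) + g (- y)) = (\<lambda>y. - (source1 k1 k2 (?v y) - source2 k1 k2 k3 (?u y) (?v y)))"
      by (simp add: f_def g_def r source1_def source2_def fun_eq_iff)
    finally show ?thesis
      unfolding exp_primitive_minus E by simp
  qed
  have jump: "source_jump k1 k2 k3 (p i) (u (q i)) (v (q i)) = 2 * (pd i + p i * qd i)"
      "source_jump k1 k2 k3 (p i) (u (q i)) (- v (q i)) = - 2 * (pd i - p i * qd i)" if "i \<in> I" for i
    unfolding source_jump_def pd[OF that] qd[OF that] by (simp_all add: algebra_simps)
  have "P1 x + ?D = 1 / 2 * (exp (- x) * (exp_primitive f x - exp_primitive g x)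
      + exp x * (exp_primitive (\<lambda>y. f (- y)) (- x) + exp_primitive (\<lambda>y. g (- y)) (- x)))"
    unfolding P1 by (simp add: field_simps)
  also have "\<dots> = 1 / 2 * (source_primitive k1 k2 k3 (u x) (v x) - source_primitive k1 k2 k3 (u x) (- v x))
      - 1 / 2 * (exp (- x) * (\<Sum>i\<in>I. if q i < x then exp (q i) * source_jump k1 k2 k3 (p i) (u (q i)) (v (q i)) else 0)
         - exp x * (\<Sum>i\<in>I. if x < q i then exp (- q i) * source_jump k1 k2 k3 (p i) (u (q i)) (- v (q i)) else 0))"
  proof -
    have "exp (- x) * (exp x * a - b) + exp x * (- (exp (- x) * c) + d) = (a - c) - (exp (- x) * b - exp x * d)"
      for a b c d :: real
      by (simp add: algebra_simps exp_minus)
    then show ?thesis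
      unfolding lower upper by (simp only: right_diff_distrib)
  qed
  also have "1 / 2 * (exp (- x) * (\<Sum>i\<in>I. if q i < x then exp (q i) * source_jump k1 k2 k3 (p i) (u (q i)) (v (q i)) else 0)
         - exp x * (\<Sum>i\<in>I. if x < q i then exp (- q i) * source_jump k1 k2 k3 (p i) (u (q i)) (- v (q i)) else 0))
      = ut x"
    unfolding ut_def sum_distrib_left sum_subtractf[symmetric]
  proof (rule sum.cong[OF refl])
    fix i assume i: "i \<in> I"
    then consider "q i < x" | "x < q i" using x by (metis imageI linorder_neqE)
    then show "1 / 2 * (exp (- x) * (if q i < x then exp (q i) * source_jump k1 k2 k3 (p i) (u (q i)) (v (q i)) else 0)
        - exp x * (if x < q i then exp (- q i) * source_jump k1 k2 k3 (p i) (u (q i)) (- v (q i)) else 0))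
      = (pd i + p i * qd i * sgn (x - q i)) * exp (- \<bar>x - q i\<bar>)"
      by cases (simp_all add: jump[OF i] exp_diff exp_minus field_simps)
  qed
  also have "1 / 2 * (source_primitive k1 k2 k3 (u x) (v x) - source_primitive k1 k2 k3 (u x) (- v x))
      = k1 / 3 * v x ^ 3 - (k1 + k2) * u x ^ 2 * v x - k3 * u x * v x"
    by (simp add: source_primitive_def field_simps)
  finally have main: "(k1 + k2) * u x ^ 2 * v x + k3 * u x * v x + ?D = - ut x + k1 / 3 * v x ^ 3 - P1 x"
    by (simp only: algebra_simps) 
  have "((\<lambda>x. (k1 + k2) / 3 * u x ^ 3 + k3 / 2 * u x ^ 2 + P2 x) has_real_derivative
           (k1 + k2) * u x ^ 2 * v x + k3 * u x * v x + ?D) (at x)"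
  proof (rule DERIV_add[OF _ dP2])
    show "((\<lambda>x. (k1 + k2) / 3 * u x ^ 3 + k3 / 2 * u x ^ 2) has_real_derivative
        (k1 + k2) * u x ^ 2 * v x + k3 * u x * v x) (at x)"
      by (auto intro!: derivative_eq_intros u simp: field_simps power2_eq_square)
  qed
  then show ?thesis
    unfolding main .
qed

text \<open>
  The exceptional points contribute no boundary terms because \<open>G\<close> is continuous across them.
\<close>
lemma integral_by_parts_finite_exceptions:
  fixes G G' \<psi> \<psi>' :: "real \<Rightarrow> real"
  assumes S: "finite S" and contG: "\<And>x. isCont G x"
    and derG: "\<And>x. x \<notin> S \<Longrightarrow> (G has_real_derivative G' x) (at x)"
    and mG'[measurable]: "G' \<in> borel_measurable borel" and bG': "\<And>x. \<bar>G' x\<bar> \<le> M"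
    and der\<psi>: "\<And>x. (\<psi> has_real_derivative \<psi>' x) (at x)"
    and cont\<psi>': "continuous_on UNIV \<psi>'"
    and supp: "\<And>x. R < \<bar>x\<bar> \<Longrightarrow> \<psi> x = 0"
  shows "integrable lborel (\<lambda>x. G x * \<psi>' x)" and "integrable lborel (\<lambda>x. G' x * \<psi> x)"
    and "(LINT x|lborel. G x * \<psi>' x) = - (LINT x|lborel. G' x * \<psi> x)"
proof -
  have cG: "continuous_on UNIV G"
    using contG by (simp add: continuous_on_eq_continuous_at)
  have c\<psi>: "continuous_on UNIV \<psi>"
    using der\<psi> by (auto simp: continuous_on_eq_continuous_at intro: DERIV_isCont)
  have [measurable]: "G \<in> borel_measurable borel" "\<psi> \<in> borel_measurable borel" "\<psi>' \<in> borel_measurable borel"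
    by (auto intro: borel_measurable_continuous_onI cG c\<psi> cont\<psi>')
  have supp': "\<psi>' x = 0" if "R < \<bar>x\<bar>" for x
  proof -
    have "open {x::real. R < \<bar>x\<bar>}"
      by (intro open_Collect_less continuous_intros)
    then have "eventually (\<lambda>y. y \<in> {x. R < \<bar>x\<bar>}) (nhds x)"
      using that by (intro eventually_nhds_in_open) auto
    then have "eventually (\<lambda>y. \<psi> y = 0) (nhds x)"
      by eventually_elim (simp add: supp)
    then have "(\<psi> has_real_derivative \<psi>' x) (at x) \<longleftrightarrow> ((\<lambda>_. 0) has_real_derivative \<psi>' x) (at x)"
      by (intro DERIV_cong_ev) auto
    with der\<psi>[of x] show ?thesis
      by (metis DERIV_const DERIV_unique)
  qed
  define K where "K = {- \<bar>R\<bar>..\<bar>R\<bar>}"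
  have K: "x \<notin> K \<Longrightarrow> \<psi> x = 0" "x \<notin> K \<Longrightarrow> \<psi>' x = 0" for x
    by (auto simp: K_def intro!: supp supp')
  have bounded: "\<exists>B. \<forall>x\<in>K. \<bar>h x\<bar> \<le> B" if "continuous_on UNIV h" for h :: "real \<Rightarrow> real"
  proof -
    have "compact (h ` K)"
      unfolding K_def by (intro compact_continuous_image continuous_on_subset[OF that]) auto
    then show ?thesis
      using compact_imp_bounded[of "h ` K"] by (auto simp: bounded_iff)
  qed
  obtain B1 where B1: "\<forall>x\<in>K. \<bar>G x * \<psi>' x\<bar> \<le> B1"
    using bounded[of "\<lambda>x. G x * \<psi>' x"] cG cont\<psi>' by (auto intro: continuous_intros)
  obtain B2 where B2: "\<forall>x\<in>K. \<bar>\<psi> x\<bar> \<le> B2"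
    using bounded[OF c\<psi>] by auto
  have M: "0 \<le> M" using bG'[of 0] by linarith
  have fK: "emeasure lborel K < \<infinity>" "K \<in> sets lborel"
    by (simp_all add: K_def)
  show i1: "integrable lborel (\<lambda>x. G x * \<psi>' x)"
    using fK B1 K by (intro integrableI_bounded_set[where A = K and B = B1]) auto
  show i2: "integrable lborel (\<lambda>x. G' x * \<psi> x)"
  proof (rule integrableI_bounded_set[where A = K and B = "M * B2"])
    show "AE x in lborel. x \<in> K \<longrightarrow> norm (G' x * \<psi> x) \<le> M * B2"
      using bG' B2 M by (auto simp: abs_mult intro!: mult_mono)
  qed (use fK K in auto)
  have "((\<lambda>x. G' x * \<psi> x + G x * \<psi>' x) has_integral
      (G (\<bar>R\<bar> + 1) * \<psi> (\<bar>R\<bar> + 1) - G (- \<bar>R\<bar> - 1) * \<psi> (- \<bar>R\<bar> - 1))) {- \<bar>R\<bar> - 1..\<bar>R\<bar> + 1}"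
  proof (rule fundamental_theorem_of_calculus_interior_strong[OF S])
    show "continuous_on {- \<bar>R\<bar> - 1..\<bar>R\<bar> + 1} (\<lambda>x. G x * \<psi> x)"
      by (intro continuous_on_mult continuous_on_subset[OF cG] continuous_on_subset[OF c\<psi>]) auto
    show "((\<lambda>x. G x * \<psi> x) has_vector_derivative G' x * \<psi> x + G x * \<psi>' x) (at x)"
      if "x \<in> {- \<bar>R\<bar> - 1<..<\<bar>R\<bar> + 1} - S" for x
      using DERIV_mult[OF derG der\<psi>, of x] that
      by (simp add: has_real_derivative_iff_has_vector_derivative mult.commute add.commute)
  qed simp
  then have "((\<lambda>x. G' x * \<psi> x + G x * \<psi>' x) has_integral 0) {- \<bar>R\<bar> - 1..\<bar>R\<bar> + 1}"
    by (simp add: supp)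
  moreover have "G' x * \<psi> x + G x * \<psi>' x = 0" if "x \<notin> {- \<bar>R\<bar> - 1..\<bar>R\<bar> + 1}" for x
    using K[of x] that by (auto simp: K_def)
  ultimately have "((\<lambda>x. G' x * \<psi> x + G x * \<psi>' x) has_integral 0) UNIV"
    by (rule has_integral_on_superset) auto
  moreover have "((\<lambda>x. G' x * \<psi> x + G x * \<psi>' x) has_integral
      (LINT x|lborel. G' x * \<psi> x + G x * \<psi>' x)) UNIV"
    using i1 i2 by (intro has_integral_integral_lborel) auto
  ultimately have "(LINT x|lborel. G' x * \<psi> x + G x * \<psi>' x) = 0"
    by (rule has_integral_unique[symmetric])
  then show "(LINT x|lborel. G x * \<psi>' x) = - (LINT x|lborel. G' x * \<psi> x)"
    using i1 i2 by simp
qed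

section \<open>Peakons moving in time\<close>

text \<open>
  The absolute value is not differentiable where \<open>h\<close> vanishes, and a peak may pass a given point
  at infinitely many times. Replacing \<open>\<bar>z\<bar>\<close> by \<open>sqrt (z\<^sup>2 + \<epsilon>\<^sup>2)\<close> makes the fundamental theorem applicable. The
  derivative \<open>z / sqrt (z\<^sup>2 + \<epsilon>\<^sup>2)\<close> is bounded by 1 and tends to \<open>sgn z\<close> for every \<open>z\<close>, also for \<open>z = 0\<close>, so
  dominated convergence gives the claim.
\<close>
lemma moving_peakon_has_integral:
  fixes g h g' h' :: "real \<Rightarrow> real"
  assumes ab: "a \<le> b"
    and g: "\<And>s. s \<in> {a..b} \<Longrightarrow> (g has_real_derivative g' s) (at s within {a..b})"
    and h: "\<And>s. s \<in> {a..b} \<Longrightarrow> (h has_real_derivative h' s) (at s within {a..b})"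
    and g': "continuous_on {a..b} g'" and h': "continuous_on {a..b} h'"
  shows "((\<lambda>s. g' s * exp (- \<bar>h s\<bar>) - g s * h' s * sgn (h s) * exp (- \<bar>h s\<bar>)) has_integral
           (g b * exp (- \<bar>h b\<bar>) - g a * exp (- \<bar>h a\<bar>))) {a..b}"
proof -
  define r where "r = (\<lambda>n z. sqrt (z\<^sup>2 + (inverse (real (Suc n)))\<^sup>2))"
  define f where "f = (\<lambda>n s. g' s * exp (- r n (h s)) - g s * h' s * (h s / r n (h s)) * exp (- r n (h s)))"
  define F where "F = (\<lambda>s. g' s * exp (- \<bar>h s\<bar>) - g s * h' s * sgn (h s) * exp (- \<bar>h s\<bar>))"
  have pos: "0 < z\<^sup>2 + (inverse (real (Suc n)))\<^sup>2" for z :: real and n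
    by (intro add_nonneg_pos) auto
  have r0: "0 < r n z" and rz: "\<bar>z\<bar> \<le> r n z" for n z
  proof -
    show "0 < r n z" using pos by (simp add: r_def)
    have "sqrt (z\<^sup>2) \<le> sqrt (z\<^sup>2 + (inverse (real (Suc n)))\<^sup>2)"
      by (intro real_sqrt_le_mono) simp
    then show "\<bar>z\<bar> \<le> r n z" by (simp add: r_def)
  qed
  have r_lim: "(\<lambda>n. r n z) \<longlonglongrightarrow> \<bar>z\<bar>" for z
  proof -
    have "(\<lambda>n. r n z) \<longlonglongrightarrow> sqrt (z\<^sup>2 + 0\<^sup>2)"
      unfolding r_def by (intro tendsto_intros LIMSEQ_inverse_real_of_nat)
    then show ?thesis by simp
  qed
  have sgn_lim: "(\<lambda>n. z / r n z) \<longlonglongrightarrow> sgn z" for z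
  proof (cases "z = 0")
    case False
    then have "(\<lambda>n. z / r n z) \<longlonglongrightarrow> z / \<bar>z\<bar>"
      by (intro tendsto_divide r_lim tendsto_const) auto
    with False show ?thesis by (simp add: sgn_if abs_if split: if_splits)
  qed simp
  have ftc: "(f n has_integral (g b * exp (- r n (h b)) - g a * exp (- r n (h a)))) {a..b}" for n
  proof (rule fundamental_theorem_of_calculus[OF ab])
    fix s assume s: "s \<in> {a..b}"
    have "((\<lambda>s. r n (h s)) has_real_derivative h s / r n (h s) * h' s) (at s within {a..b})"
      unfolding r_def using pos[of "h s" n] h[OF s]
      by (auto intro!: derivative_eq_intros simp: field_simps)
    then have "((\<lambda>s. g s * exp (- r n (h s))) has_real_derivative f n s) (at s within {a..b})"
      using g[OF s] by (auto intro!: derivative_eq_intros simp: f_def algebra_simps)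
    then show "((\<lambda>s. g s * exp (- r n (h s))) has_vector_derivative f n s) (at s within {a..b})"
      by (simp add: has_real_derivative_iff_has_vector_derivative)
  qed
  have cg: "continuous_on {a..b} g"
    by (rule DERIV_continuous_on[OF g])
  have dom: "(\<lambda>s. \<bar>g' s\<bar> + \<bar>g s * h' s\<bar>) integrable_on {a..b}"
    by (intro integrable_continuous_interval continuous_intros cg g' h')
  have bound: "norm (f n s) \<le> \<bar>g' s\<bar> + \<bar>g s * h' s\<bar>" for n s
  proof -
    have e: "exp (- r n (h s)) \<le> 1" using r0[of n "h s"] by simp
    have q: "\<bar>h s / r n (h s)\<bar> \<le> 1" using rz[of "h s" n] r0[of n "h s"] by (simp add: abs_divide)
    have "\<bar>g' s * exp (- r n (h s))\<bar> \<le> \<bar>g' s\<bar>"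
      using e by (simp add: abs_mult mult_left_le)
    moreover have "\<bar>g s * h' s * (h s / r n (h s)) * exp (- r n (h s))\<bar> \<le> \<bar>g s * h' s\<bar>"
    proof -
      have "\<bar>h s / r n (h s)\<bar> * exp (- r n (h s)) \<le> 1"
        using e q by (intro mult_le_one) auto
      then have "\<bar>g s * h' s\<bar> * (\<bar>h s / r n (h s)\<bar> * exp (- r n (h s))) \<le> \<bar>g s * h' s\<bar>"
        by (intro mult_left_le) auto
      then show ?thesis by (simp only: abs_mult abs_exp_cancel mult.assoc)
    qed
    ultimately show ?thesis
      unfolding f_def real_norm_def by (rule order_trans[OF abs_triangle_ineq4 add_mono])
  qed
  have lim: "(\<lambda>n. f n s) \<longlonglongrightarrow> F s" for s
    unfolding f_def F_def by (intro tendsto_intros r_lim sgn_lim)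
  have int: "F integrable_on {a..b}" and conv: "(\<lambda>n. integral {a..b} (f n)) \<longlonglongrightarrow> integral {a..b} F"
    using dominated_convergence[OF has_integral_integrable[OF ftc] dom bound lim] by auto
  have "(\<lambda>n. g b * exp (- r n (h b)) - g a * exp (- r n (h a)))
      \<longlonglongrightarrow> g b * exp (- \<bar>h b\<bar>) - g a * exp (- \<bar>h a\<bar>)"
    by (intro tendsto_intros r_lim)
  then have "integral {a..b} F = g b * exp (- \<bar>h b\<bar>) - g a * exp (- \<bar>h a\<bar>)"
    using conv unfolding integral_unique[OF ftc] by (rule LIMSEQ_unique[rotated])
  then have "(F has_integral (g b * exp (- \<bar>h b\<bar>) - g a * exp (- \<bar>h a\<bar>))) {a..b}"
    using integrable_integral[OF int] by simp
  then show ?thesis unfolding F_def .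
qed

section \<open>Test functions on the strip\<close>

lemma time_dom_measurable [measurable]: "time_dom T \<in> sets borel"
proof -
  have "time_dom T = {0..} \<inter> {t. ereal t < T}"
    by (auto simp: time_dom_def)
  then show ?thesis by simp
qed

lemma time_dom_downward: "b \<in> time_dom T \<Longrightarrow> 0 \<le> t \<Longrightarrow> t \<le> b \<Longrightarrow> t \<in> time_dom T"
  by (auto simp: time_dom_def intro: le_less_trans[of "ereal t" "ereal b" T])

lemma time_dom_extend:
  assumes "t \<in> time_dom T"
  obtains b where "t < b" "b \<in> time_dom T"
proof -
  from assms have "0 \<le> t" "ereal t < T" by (auto simp: time_dom_def)
  then obtain b where "ereal t < ereal b" "ereal b < T"
    using ereal_dense2 by blast
  with \<open>0 \<le> t\<close> show thesis by (intro that[of b]) (auto simp: time_dom_def)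
qed

lemma at_within_time_dom_neq_bot:
  assumes "t \<in> time_dom T"
  shows "at t within time_dom T \<noteq> bot"
proof -
  obtain b where b: "t < b" "b \<in> time_dom T" using time_dom_extend[OF assms] .
  have "{t..b} \<subseteq> time_dom T"
  proof
    fix s assume "s \<in> {t..b}"
    moreover have "0 \<le> t" using assms by (simp add: time_dom_def)
    ultimately show "s \<in> time_dom T" by (intro time_dom_downward[OF b(2)]) auto
  qed
  then have "at t within {t..b} \<le> at t within time_dom T"
    by (rule at_le)
  moreover have "at t within {t..b} \<noteq> bot"
    using b by (simp add: at_within_Icc_at_right)
  ultimately show ?thesis by (metis bot.extremum_uniqueI)
qed

lemma test_fun_strip_derivs:
  assumes "test_fun_strip T \<phi>" and t: "t \<in> time_dom T"
  shows "((\<lambda>s. \<phi> s x) has_real_derivative dt T \<phi> t x) (at t within time_dom T)"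
    and "(\<phi> t has_real_derivative dx \<phi> t x) (at x)"
proof -
  have "Ck_strip T (Suc 0) \<phi>"
    using assms(1) unfolding test_fun_strip_def by blast
  then have d: "(\<lambda>s. \<phi> s x) differentiable (at t within time_dom T)" "\<phi> t differentiable (at x)"
    using t by simp_all
  show "((\<lambda>s. \<phi> s x) has_real_derivative dt T \<phi> t x) (at t within time_dom T)"
    using d(1) unfolding vector_derivative_works dt_def has_real_derivative_iff_has_vector_derivative .
  show "(\<phi> t has_real_derivative dx \<phi> t x) (at x)"
    using d(2) unfolding dx_def by (simp add: DERIV_deriv_iff_real_differentiable)
qed

lemma test_fun_strip_continuous:
  assumes "test_fun_strip T \<phi>"
  shows "continuous_on (time_dom T \<times> UNIV) (\<lambda>(t, x). \<phi> t x)"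
    and "continuous_on (time_dom T \<times> UNIV) (\<lambda>(t, x). dt T \<phi> t x)"
    and "continuous_on (time_dom T \<times> UNIV) (\<lambda>(t, x). dx \<phi> t x)"
proof -
  have "Ck_strip T (Suc 0) \<phi>"
    using assms(1) unfolding test_fun_strip_def by blast
  then show "continuous_on (time_dom T \<times> UNIV) (\<lambda>(t, x). \<phi> t x)"
    "continuous_on (time_dom T \<times> UNIV) (\<lambda>(t, x). dt T \<phi> t x)"
    "continuous_on (time_dom T \<times> UNIV) (\<lambda>(t, x). dx \<phi> t x)"
    by simp_all
qed

text \<open>
  The time \<open>b\<close> is chosen strictly beyond the support, so that the derivatives vanish at \<open>b\<close> as well.
\<close>
lemma test_fun_strip_support:
  assumes \<phi>: "test_fun_strip T \<phi>" and T: "T > 0"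
  obtains b R where "b \<in> time_dom T" "0 < b"
    and "\<And>t x. t \<in> time_dom T \<Longrightarrow> b \<le> t \<or> R < \<bar>x\<bar> \<Longrightarrow> \<phi> t x = 0"
    and "\<And>t x. t \<in> time_dom T \<Longrightarrow> b \<le> t \<or> R < \<bar>x\<bar> \<Longrightarrow> dt T \<phi> t x = 0"
    and "\<And>t x. t \<in> time_dom T \<Longrightarrow> b \<le> t \<or> R < \<bar>x\<bar> \<Longrightarrow> dx \<phi> t x = 0"
proof -
  obtain K where K: "compact K" "K \<subseteq> time_dom T \<times> UNIV"
      and zero: "\<And>t x. t \<in> time_dom T \<Longrightarrow> (t, x) \<notin> K \<Longrightarrow> \<phi> t x = 0"
    using \<phi> unfolding test_fun_strip_def by blast
  have 0: "0 \<in> time_dom T"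
    using T by (simp add: time_dom_def flip: zero_ereal_def)
  have "compact (insert 0 (fst ` K))"
    using K(1) by (intro compact_insert compact_continuous_image continuous_intros)
  then obtain m where m: "m \<in> insert 0 (fst ` K)" "\<forall>t\<in>insert 0 (fst ` K). t \<le> m"
    using compact_attains_sup[of "insert 0 (fst ` K)"] by blast
  have "m \<in> time_dom T" using m(1) K(2) 0 by auto
  then obtain b where b: "m < b" "b \<in> time_dom T" by (rule time_dom_extend)
  have "0 < b" using m(2) b(1) by auto
  have "bounded (snd ` K)"
    using K(1) by (intro compact_imp_bounded compact_continuous_image continuous_intros)
  then obtain R where R: "\<forall>x\<in>snd ` K. norm x \<le> R"
    unfolding bounded_iff by blast
  define W where "W = {z::real \<times> real. m < fst z \<or> R < \<bar>snd z\<bar>}"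
  have "open W"
    unfolding W_def by (intro open_Collect_disj open_Collect_less continuous_intros)
  have far: "\<phi> t x = 0" if "t \<in> time_dom T" "(t, x) \<in> W" for t x
  proof (rule zero[OF that(1)])
    show "(t, x) \<notin> K"
    proof
      assume "(t, x) \<in> K"
      then have "t \<in> fst ` K" "x \<in> snd ` K" by force+
      with m(2) R that(2) show False by (auto simp: W_def)
    qed
  qed
  have in_W: "(t, x) \<in> W" if "b \<le> t \<or> R < \<bar>x\<bar>" for t x
    using that b(1) by (auto simp: W_def)
  show thesis
  proof (rule that[OF b(2) \<open>0 < b\<close>, of R])
    fix t x assume t: "t \<in> time_dom T" and "b \<le> t \<or> R < \<bar>x\<bar>"
    then have W: "(t, x) \<in> W" by (intro in_W)
    then show "\<phi> t x = 0" using far t by blast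
    have "open ((\<lambda>s. (s, x)) -` W)" "open (Pair t -` W)"
      using \<open>open W\<close> by (auto intro!: open_vimage continuous_intros)
    then have ev: "eventually (\<lambda>s. s \<in> (\<lambda>s. (s, x)) -` W) (nhds t)"
        "eventually (\<lambda>y. y \<in> Pair t -` W) (nhds x)"
      using W eventually_nhds_in_open[of "(\<lambda>s. (s, x)) -` W" t] eventually_nhds_in_open[of "Pair t -` W" x]
      by simp_all
    have "eventually (\<lambda>s. \<phi> s x = 0) (at t within time_dom T)"
      using ev(1) unfolding eventually_at_filter by eventually_elim (auto intro: far)
    then have "((\<lambda>s. \<phi> s x) has_vector_derivative dt T \<phi> t x) (at t within time_dom T) \<longleftrightarrow>
        ((\<lambda>s. 0) has_vector_derivative dt T \<phi> t x) (at t within time_dom T)"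
      using t W far by (intro has_vector_derivative_cong_ev) (auto simp: eventually_at_filter elim!: eventually_mono)
    then have "((\<lambda>s. 0) has_vector_derivative dt T \<phi> t x) (at t within time_dom T)"
      using test_fun_strip_derivs(1)[OF \<phi> t] by (simp add: has_real_derivative_iff_has_vector_derivative)
    then show "dt T \<phi> t x = 0"
      by (rule vector_derivative_unique_within[OF at_within_time_dom_neq_bot[OF t] _ has_vector_derivative_const])
    have "eventually (\<lambda>y. \<phi> t y = 0) (nhds x)"
      using ev(2) by eventually_elim (auto intro: far t)
    then have "(\<phi> t has_real_derivative dx \<phi> t x) (at x) \<longleftrightarrow> ((\<lambda>_. 0) has_real_derivative dx \<phi> t x) (at x)"
      by (intro DERIV_cong_ev) auto
    then show "dx \<phi> t x = 0"
      using test_fun_strip_derivs(2)[OF \<phi> t] by (metis DERIV_const DERIV_unique)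
  qed
qed

section \<open>Sobolev regularity of peakon superpositions\<close>

lemma integrable_lborel_compact_support:
  fixes f :: "'a::euclidean_space \<Rightarrow> real"
  assumes "f \<in> borel_measurable borel" "compact K"
    and "\<And>x. x \<in> K \<Longrightarrow> \<bar>f x\<bar> \<le> B" "\<And>x. x \<notin> K \<Longrightarrow> f x = 0"
  shows "integrable lborel f"
  using assms emeasure_compact_finite[OF assms(2)]
  by (intro integrableI_bounded_set[where A = K and B = B]) (auto intro: borel_compact)

lemma peakon_weak_deriv:
  assumes "finite I"
  shows "has_weak_deriv (peakon_sum I p q) (peakon_slope I p q)"
  unfolding has_weak_deriv_def
proof (intro conjI allI impI)
  fix K :: "real set" assume "compact K"
  have *: "set_integrable lebesgue K f"
    if [measurable]: "f \<in> borel_measurable borel" and "\<And>x. \<bar>f x\<bar> \<le> (\<Sum>i\<in>I. \<bar>p i\<bar>)" for f :: "real \<Rightarrow> real"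
  proof -
    have [measurable]: "K \<in> sets borel" using \<open>compact K\<close> by (rule borel_compact)
    have "integrable lborel (\<lambda>x. indicator K x *\<^sub>R f x)"
      using that \<open>compact K\<close>
      by (intro integrable_lborel_compact_support[where K = K and B = "\<Sum>i\<in>I. \<bar>p i\<bar>"]) auto
    then show ?thesis
      unfolding set_integrable_def by (subst integrable_completion) auto
  qed
  show "set_integrable lebesgue K (peakon_sum I p q)" "set_integrable lebesgue K (peakon_slope I p q)"
    by (auto intro!: * abs_peakon_sum_le abs_peakon_slope_le)
next
  fix \<psi> assume \<psi>: "test_fun \<psi>"
  then obtain K where K: "compact K" "\<And>x. x \<notin> K \<Longrightarrow> \<psi> x = 0"
    unfolding test_fun_def by blast
  then obtain R where R: "\<And>x. x \<in> K \<Longrightarrow> norm x \<le> R"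
    using compact_imp_bounded[OF K(1)] unfolding bounded_iff by blast
  have d: "\<psi> differentiable (at x)" "deriv \<psi> differentiable (at x)" for x
  proof -
    have *: "((deriv ^^ n) \<psi>) differentiable (at x)" for n
      using \<psi> unfolding test_fun_def by blast
    show "\<psi> differentiable (at x)" "deriv \<psi> differentiable (at x)"
      using *[of 0] *[of 1] by simp_all
  qed
  have D: "(\<psi> has_real_derivative deriv \<psi> x) (at x)" for x
    using d(1) by (simp add: DERIV_deriv_iff_real_differentiable)
  have c': "continuous_on UNIV (deriv \<psi>)"
    using d(2) by (intro differentiable_imp_continuous_on) (auto simp: differentiable_on_def)
  have c: "continuous_on UNIV \<psi>"
    using d(1) by (intro differentiable_imp_continuous_on) (auto simp: differentiable_on_def)
  have [measurable]: "\<psi> \<in> borel_measurable borel" "deriv \<psi> \<in> borel_measurable borel"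
    by (auto intro: borel_measurable_continuous_onI c c')
  have "(LINT x|lborel. peakon_sum I p q x * deriv \<psi> x) = - (LINT x|lborel. peakon_slope I p q x * \<psi> x)"
  proof (rule integral_by_parts_finite_exceptions(3)[where S = "q ` I" and M = "\<Sum>i\<in>I. \<bar>p i\<bar>" and R = R])
    show "\<psi> x = 0" if "R < \<bar>x\<bar>" for x
      using K(2)[of x] R[of x] that by force
  qed (use assms in \<open>auto intro: isCont_peakon_sum peakon_sum_deriv abs_peakon_slope_le D c'\<close>)
  then show "(LINT x|lebesgue. peakon_sum I p q x * deriv \<psi> x)
      = - (LINT x|lebesgue. peakon_slope I p q x * \<psi> x)"
    by (simp add: integral_completion)
qed

lemma peakon_cube_integrable:
  fixes f :: "real \<Rightarrow> real"
  assumes [measurable]: "f \<in> borel_measurable borel"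
    and bd: "\<And>x. \<bar>f x\<bar> \<le> (\<Sum>i\<in>I. \<bar>p i\<bar> * exp (- \<bar>x - q i\<bar>))"
  shows "integrable lebesgue (\<lambda>x. \<bar>f x\<bar> ^ 3)"
proof -
  define C where "C = (\<Sum>i\<in>I. \<bar>p i\<bar>)"
  define B where "B = (\<lambda>x. \<Sum>i\<in>I. \<bar>p i\<bar> * exp (- \<bar>x - q i\<bar>))"
  have BC: "B x \<le> C" "0 \<le> B x" for x
  proof -
    show "B x \<le> C" unfolding B_def C_def by (rule sum_mono) (simp add: mult_left_le)
    show "0 \<le> B x" unfolding B_def by (rule sum_nonneg) simp
  qed
  have i1: "integrable lborel (\<lambda>x. exp (- \<bar>x - a\<bar>))" for a :: real
    using integrable_mult_right[OF conv_pker_eq_exp_primitives(1)[of "\<lambda>_. 1" 1 a], of 2]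
    by (simp add: pker_def abs_minus_commute)
  have iB: "integrable lborel B"
    unfolding B_def by (intro Bochner_Integration.integrable_sum integrable_mult_right i1)
  have "integrable lborel (\<lambda>x. \<bar>f x\<bar> ^ 3)"
  proof (rule Bochner_Integration.integrable_bound)
    show "integrable lborel (\<lambda>x. C\<^sup>2 * B x)"
      using iB by (rule integrable_mult_right)
    show "AE x in lborel. norm (\<bar>f x\<bar> ^ 3) \<le> norm (C\<^sup>2 * B x)"
    proof (rule AE_I2)
      fix x
      have fB: "\<bar>f x\<bar> \<le> B x" using bd by (simp add: B_def)
      then have "\<bar>f x\<bar> ^ 2 * \<bar>f x\<bar> \<le> C\<^sup>2 * B x"
        using BC[of x] by (intro mult_mono power_mono) auto
      then show "norm (\<bar>f x\<bar> ^ 3) \<le> norm (C\<^sup>2 * B x)"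
        using BC[of x] by (simp add: power2_eq_square power3_eq_cube)
    qed
  qed measurable
  then show ?thesis by (subst integrable_completion) auto
qed

lemma peakon_sum_in_W13:
  assumes "finite I"
  shows "peakon_sum I p q \<in> W13"
proof -
  have "integrable lebesgue (\<lambda>x. \<bar>peakon_sum I p q x\<bar> ^ 3)"
  proof (rule peakon_cube_integrable[where I = I and p = p and q = q])
    fix x
    show "\<bar>peakon_sum I p q x\<bar> \<le> (\<Sum>i\<in>I. \<bar>p i\<bar> * exp (- \<bar>x - q i\<bar>))"
      unfolding peakon_sum_def
      by (rule order_trans[OF sum_abs]) (simp add: abs_mult)
  qed simp
  moreover have "integrable lebesgue (\<lambda>x. \<bar>peakon_slope I p q x\<bar> ^ 3)"
  proof (rule peakon_cube_integrable[where I = I and p = p and q = q])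
    fix x
    show "\<bar>peakon_slope I p q x\<bar> \<le> (\<Sum>i\<in>I. \<bar>p i\<bar> * exp (- \<bar>x - q i\<bar>))"
      unfolding peakon_slope_def abs_minus_cancel
      by (rule order_trans[OF sum_abs]) (auto intro!: sum_mono simp: abs_mult abs_sgn_eq)
  qed simp
  ultimately show ?thesis
    using peakon_weak_deriv[OF assms] unfolding W13_def by blast
qed

section \<open>The spatial identity against a test function\<close>

lemma peakon_spatial_identity:
  fixes p q pd qd :: "'i \<Rightarrow> real" and \<psi> \<psi>' :: "real \<Rightarrow> real"
  assumes fin: "finite I" and inj: "inj_on q I"
  defines "u \<equiv> peakon_sum I p q" and "v \<equiv> peakon_slope I p q"
  assumes pd: "\<And>i. i \<in> I \<Longrightarrow> pd i = - p i * v (q i) * (k2 * u (q i) + k3)"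
    and qd: "\<And>i. i \<in> I \<Longrightarrow> qd i = - (k1 / 3) * (p i)\<^sup>2 - k1 * (v (q i))\<^sup>2
                + (k1 + k2) * (u (q i))\<^sup>2 + k3 * u (q i)"
    and der\<psi>: "\<And>x. (\<psi> has_real_derivative \<psi>' x) (at x)"
    and cont\<psi>': "continuous_on UNIV \<psi>'"
    and supp: "\<And>x. R < \<bar>x\<bar> \<Longrightarrow> \<psi> x = 0"
  defines "ut \<equiv> (\<lambda>x. \<Sum>i\<in>I. (pd i + p i * qd i * sgn (x - q i)) * exp (- \<bar>x - q i\<bar>))"
  defines "P1 \<equiv> conv pker (\<lambda>y. source1 k1 k2 (v y))"
    and "P2 \<equiv> conv pker (\<lambda>y. source2 k1 k2 k3 (u y) (v y))"
  defines "E \<equiv> (\<lambda>x. ((k1 + k2) / 3 * u x ^ 3 + k3 / 2 * u x ^ 2 + P2 x) * \<psi>' x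
                  + (- ut x + k1 / 3 * v x ^ 3 - P1 x) * \<psi> x)"
  shows "integrable lborel E" and "(LINT x|lborel. E x) = 0"
proof -
  define G where "G = (\<lambda>x. (k1 + k2) / 3 * u x ^ 3 + k3 / 2 * u x ^ 2 + P2 x)"
  define H where "H = (\<lambda>x. - ut x + k1 / 3 * v x ^ 3 - P1 x)"
  have cf: "continuous_on UNIV (\<lambda>(u, v). source1 k1 k2 v)"
    unfolding source1_def split_def by (intro continuous_intros)
  have cg: "continuous_on UNIV (\<lambda>(u, v). source2 k1 k2 k3 u v)"
    unfolding source2_def split_def by (intro continuous_intros)
  have cv: "continuous_on UNIV (\<lambda>(u::real, v). k1 / 3 * v ^ 3)"
    unfolding split_def by (intro continuous_intros)
  obtain M where Mf: "\<And>y. \<bar>source1 k1 k2 (v y)\<bar> \<le> M"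
    using peakon_composite_bounded[OF cf, where I=I and p=p and q=q] unfolding v_def by blast
  obtain M' where Mg: "\<And>y. \<bar>source2 k1 k2 k3 (u y) (v y)\<bar> \<le> M'"
    using peakon_composite_bounded[OF cg, where I=I and p=p and q=q] unfolding u_def v_def by blast
  obtain M'' where Mv: "\<And>y. \<bar>k1 / 3 * v y ^ 3\<bar> \<le> M''"
    using peakon_composite_bounded[OF cv, where I=I and p=p and q=q] unfolding v_def by blast
  have [measurable]: "u \<in> borel_measurable borel" "v \<in> borel_measurable borel"
    unfolding u_def v_def by measurable
  have mf[measurable]: "(\<lambda>y. source1 k1 k2 (v y)) \<in> borel_measurable borel"
    unfolding source1_def by measurable
  have mg[measurable]: "(\<lambda>y. source2 k1 k2 k3 (u y) (v y)) \<in> borel_measurable borel"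
    unfolding source2_def by measurable
  have cP: "isCont P1 x" "isCont P2 x" for x
    unfolding P1_def P2_def by (rule isCont_conv_pker[OF mf Mf], rule isCont_conv_pker[OF mg Mg])
  have [measurable]: "P1 \<in> borel_measurable borel" "P2 \<in> borel_measurable borel"
    using cP by (auto intro!: borel_measurable_continuous_onI simp: continuous_on_eq_continuous_at)
  have [measurable]: "ut \<in> borel_measurable borel"
    unfolding ut_def by measurable
  have contG: "isCont G x" for x
    unfolding G_def using isCont_peakon_sum[where I=I and p=p and q=q and x=x] cP
    by (intro continuous_intros) (auto simp: u_def)
  have mH: "H \<in> borel_measurable borel"
    unfolding H_def by measurable
  have but: "\<bar>ut x\<bar> \<le> (\<Sum>i\<in>I. \<bar>pd i\<bar> + \<bar>p i * qd i\<bar>)" for x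
    unfolding ut_def
  proof (rule order_trans[OF sum_abs sum_mono])
    fix i assume "i \<in> I"
    have "\<bar>pd i + p i * qd i * sgn (x - q i)\<bar> \<le> \<bar>pd i\<bar> + \<bar>p i * qd i\<bar>"
      by (rule order_trans[OF abs_triangle_ineq]) (simp add: abs_mult abs_sgn_eq)
    then show "\<bar>(pd i + p i * qd i * sgn (x - q i)) * exp (- \<bar>x - q i\<bar>)\<bar> \<le> \<bar>pd i\<bar> + \<bar>p i * qd i\<bar>"
      unfolding abs_mult[of _ "exp _"] by (rule order_trans[rotated]) (simp add: mult_left_le)
  qed
  have bP1: "\<bar>P1 x\<bar> \<le> M" for x
    unfolding P1_def conv_lborel[OF mf] by (rule abs_conv_pker_le[OF mf Mf])
  have bH: "\<bar>H x\<bar> \<le> (\<Sum>i\<in>I. \<bar>pd i\<bar> + \<bar>p i * qd i\<bar>) + M'' + M" for x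
    using but[of x] Mv[of x] bP1[of x] unfolding H_def by linarith
  have dG: "(G has_real_derivative H x) (at x)" if "x \<notin> q ` I" for x
    unfolding G_def H_def u_def v_def ut_def P1_def P2_def
    using pd qd by (intro peakon_equation_off_peaks[OF fin inj that]) (simp_all add: u_def v_def)
  note parts = integral_by_parts_finite_exceptions[OF finite_imageI[OF fin] contG dG mH bH der\<psi> cont\<psi>' supp]
  have E: "E = (\<lambda>x. G x * \<psi>' x + H x * \<psi> x)"
    by (simp add: E_def G_def H_def)
  show "integrable lborel E" "(LINT x|lborel. E x) = 0"
    unfolding E using parts by simp_all
qed

section \<open>Joint measurability and integrability on the strip\<close>

lemma peakon_sum_measurable_pair:
  assumes [measurable]: "\<And>i. i \<in> I \<Longrightarrow> P i \<in> borel_measurable borel" "\<And>i. i \<in> I \<Longrightarrow> Q i \<in> borel_measurable borel"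
  shows "(\<lambda>z. peakon_sum I (\<lambda>i. P i (fst z)) (\<lambda>i. Q i (fst z)) (snd z)) \<in> borel_measurable (borel \<Otimes>\<^sub>M borel)"
    and "(\<lambda>z. peakon_slope I (\<lambda>i. P i (fst z)) (\<lambda>i. Q i (fst z)) (snd z)) \<in> borel_measurable (borel \<Otimes>\<^sub>M borel)"
  unfolding peakon_sum_def peakon_slope_def by measurable

lemma conv_pker_measurable_pair:
  assumes [measurable]: "(\<lambda>z. f (fst z) (snd z)) \<in> borel_measurable (borel \<Otimes>\<^sub>M borel)"
  shows "(\<lambda>z. LINT y|lborel. pker (snd z - y) * f (fst z) y) \<in> borel_measurable (borel \<Otimes>\<^sub>M (borel :: real measure))"
proof (rule lborel.borel_measurable_lebesgue_integral)
  have "(\<lambda>w. f (fst (fst (fst w), snd w)) (snd (fst (fst w), snd w)))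
      \<in> borel_measurable ((borel \<Otimes>\<^sub>M (borel :: real measure)) \<Otimes>\<^sub>M lborel)"
    by (rule measurable_compose[OF _ assms]) measurable
  then have [measurable]: "(\<lambda>w. f (fst (fst w)) (snd w)) \<in> borel_measurable ((borel \<Otimes>\<^sub>M (borel :: real measure)) \<Otimes>\<^sub>M lborel)"
    by simp
  show "(\<lambda>(z, y). pker (snd z - y) * f (fst z) y) \<in> borel_measurable ((borel \<Otimes>\<^sub>M (borel :: real measure)) \<Otimes>\<^sub>M lborel)"
    unfolding pker_def split_def by measurable
qed

lemma strip_extension_measurable:
  fixes f :: "real \<Rightarrow> real \<Rightarrow> real"
  assumes "continuous_on (time_dom T \<times> UNIV) (\<lambda>(t, x). f t x)"
  shows "(\<lambda>z. indicator (time_dom T) (fst z) * f (fst z) (snd z)) \<in> borel_measurable (borel \<Otimes>\<^sub>M borel)"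
proof -
  have "time_dom T \<times> (UNIV :: real set) \<in> sets borel"
    by (intro borel_Times) simp_all
  from borel_measurable_continuous_on_indicator[OF this assms] show ?thesis
    unfolding borel_prod
    by (rule measurable_cong[THEN iffD1, rotated]) (auto simp: indicator_def)
qed

lemma time_extension_measurable:
  fixes f :: "real \<Rightarrow> real"
  assumes "continuous_on (time_dom T) f"
  shows "(\<lambda>t. indicator (time_dom T) t * f t) \<in> borel_measurable borel"
  using borel_measurable_continuous_on_indicator[OF time_dom_measurable assms] by simp

lemma integrable_bounded_coefficient:
  fixes c e :: "'a \<Rightarrow> real"
  assumes e: "integrable M e" and c: "c \<in> borel_measurable M"
    and bd: "\<And>z. e z \<noteq> 0 \<Longrightarrow> \<bar>c z\<bar> \<le> B"
  shows "integrable M (\<lambda>z. c z * e z)"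
proof (rule Bochner_Integration.integrable_bound)
  show "integrable M (\<lambda>z. B * e z)" using e by (rule integrable_mult_right)
  show "(\<lambda>z. c z * e z) \<in> borel_measurable M" using c e by measurable
  show "AE z in M. norm (c z * e z) \<le> norm (B * e z)"
  proof (rule AE_I2)
    fix z
    show "norm (c z * e z) \<le> norm (B * e z)"
    proof (cases "e z = 0")
      case False
      with bd[of z] show ?thesis by (auto simp: abs_mult intro: mult_right_mono)
    qed simp
  qed
qed

lemma strip_extension_integrable:
  fixes f :: "real \<Rightarrow> real \<Rightarrow> real"
  assumes cont: "continuous_on (time_dom T \<times> UNIV) (\<lambda>(t, x). f t x)"
    and b: "b \<in> time_dom T"
    and zero: "\<And>t x. t \<in> time_dom T \<Longrightarrow> b \<le> t \<or> R < \<bar>x\<bar> \<Longrightarrow> f t x = 0"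
  shows "integrable (lborel \<Otimes>\<^sub>M lborel) (\<lambda>z. indicator (time_dom T) (fst z) * f (fst z) (snd z))"
proof -
  define K where "K = {0..b} \<times> {-R..R}"
  have K: "compact K" unfolding K_def by (intro compact_Times) auto
  have KT: "K \<subseteq> time_dom T \<times> UNIV"
    unfolding K_def by (auto intro: time_dom_downward[OF b])
  have "compact ((\<lambda>(t, x). f t x) ` K)"
    by (intro compact_continuous_image K continuous_on_subset[OF cont KT])
  then obtain B where B: "\<forall>y\<in>(\<lambda>(t, x). f t x) ` K. norm y \<le> B"
    using compact_imp_bounded bounded_iff by metis
  show ?thesis
    unfolding lborel_prod
  proof (rule integrable_lborel_compact_support[OF _ K])
    show "(\<lambda>z. indicator (time_dom T) (fst z) * f (fst z) (snd z)) \<in> borel_measurable borel"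
      using strip_extension_measurable[OF cont] by (simp add: borel_prod)
    fix z :: "real \<times> real"
    show "\<bar>indicator (time_dom T) (fst z) * f (fst z) (snd z)\<bar> \<le> B" if "z \<in> K"
    proof -
      have "\<bar>f (fst z) (snd z)\<bar> \<le> B"
        using B that by (auto simp: split_def)
      moreover have "fst z \<in> time_dom T" using KT that by auto
      ultimately show ?thesis by simp
    qed
    show "indicator (time_dom T) (fst z) * f (fst z) (snd z) = 0" if "z \<notin> K"
    proof (cases "fst z \<in> time_dom T")
      case True
      then have "b \<le> fst z \<or> R < \<bar>snd z\<bar>"
        using that by (cases z) (auto simp: K_def time_dom_def)
      with True show ?thesis by (simp add: zero)
    qed simp
  qed
qed

section \<open>Multipeakons driven by the dynamical system\<close>

text \<open>
  The sums in the dynamical system are the height and the negative slope of the multipeakon at its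
  own peaks.
\<close>
locale multipeakon_flow =
  fixes k1 k2 k3 :: real and N :: nat and T :: ereal
    and p q p' q' :: "nat \<Rightarrow> real \<Rightarrow> real"
  assumes T_pos: "T > 0"
    and p'_cont: "i \<in> {1..N} \<Longrightarrow> continuous_on (time_dom T) (p' i)"
    and q'_cont: "i \<in> {1..N} \<Longrightarrow> continuous_on (time_dom T) (q' i)"
    and p_deriv: "i \<in> {1..N} \<Longrightarrow> t \<in> time_dom T \<Longrightarrow>
          (p i has_real_derivative p' i t) (at t within time_dom T)"
    and q_deriv: "i \<in> {1..N} \<Longrightarrow> t \<in> time_dom T \<Longrightarrow>
          (q i has_real_derivative q' i t) (at t within time_dom T)"
    and q_inj: "t \<in> time_dom T \<Longrightarrow> inj_on (\<lambda>i. q i t) {1..N}"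
    and p_eq: "i \<in> {1..N} \<Longrightarrow> t \<in> time_dom T \<Longrightarrow>
      p' i t = - p i t * peakon_slope {1..N} (\<lambda>j. p j t) (\<lambda>j. q j t) (q i t)
        * (k2 * peakon_sum {1..N} (\<lambda>j. p j t) (\<lambda>j. q j t) (q i t) + k3)"
    and q_eq: "i \<in> {1..N} \<Longrightarrow> t \<in> time_dom T \<Longrightarrow>
      q' i t = - (k1 / 3) * (p i t)\<^sup>2
        - k1 * (peakon_slope {1..N} (\<lambda>j. p j t) (\<lambda>j. q j t) (q i t))\<^sup>2
        + (k1 + k2) * (peakon_sum {1..N} (\<lambda>j. p j t) (\<lambda>j. q j t) (q i t))\<^sup>2
        + k3 * peakon_sum {1..N} (\<lambda>j. p j t) (\<lambda>j. q j t) (q i t)"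
begin

definition U :: "real \<Rightarrow> real \<Rightarrow> real" where
  "U t = peakon_sum {1..N} (\<lambda>i. p i t) (\<lambda>i. q i t)"

definition V :: "real \<Rightarrow> real \<Rightarrow> real" where
  "V t = peakon_slope {1..N} (\<lambda>i. p i t) (\<lambda>i. q i t)"

text \<open>
  The time derivative of \<open>U\<close> off the peaks; at a peak it is the mean of the one-sided values.
\<close>
definition Ut :: "real \<Rightarrow> real \<Rightarrow> real" where
  "Ut t x = (\<Sum>i\<in>{1..N}. (p' i t + p i t * q' i t * sgn (x - q i t)) * exp (- \<bar>x - q i t\<bar>))"

lemma multipeakon_eq: "multipeakon N p q = U"
  by (simp add: multipeakon_def peakon_sum_def U_def fun_eq_iff)

lemma p_cont: "i \<in> {1..N} \<Longrightarrow> continuous_on (time_dom T) (p i)"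
  by (rule DERIV_continuous_on[OF p_deriv])

lemma q_cont: "i \<in> {1..N} \<Longrightarrow> continuous_on (time_dom T) (q i)"
  by (rule DERIV_continuous_on[OF q_deriv])

lemma zero_in_time_dom: "0 \<in> time_dom T"
  using T_pos by (simp add: time_dom_def flip: zero_ereal_def)

lemma bounded_on_slab:
  assumes "b \<in> time_dom T"
  obtains C where "\<And>t x. t \<in> {0..b} \<Longrightarrow> \<bar>U t x\<bar> \<le> C" "\<And>t x. t \<in> {0..b} \<Longrightarrow> \<bar>V t x\<bar> \<le> C"
    "\<And>t x. t \<in> {0..b} \<Longrightarrow> \<bar>Ut t x\<bar> \<le> C"
proof -
  define F where "F = (\<lambda>t. \<Sum>i\<in>{1..N}. \<bar>p i t\<bar> + (\<bar>p' i t\<bar> + \<bar>p i t * q' i t\<bar>))"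
  have sub: "{0..b} \<subseteq> time_dom T"
    by (auto intro: time_dom_downward[OF assms])
  have "continuous_on {0..b} F"
    unfolding F_def
    by (intro continuous_intros continuous_on_subset[OF p_cont sub] continuous_on_subset[OF p'_cont sub]
        continuous_on_subset[OF q'_cont sub])
  then have "compact (F ` {0..b})"
    by (intro compact_continuous_image) auto
  then obtain C where C: "\<forall>y\<in>F ` {0..b}. norm y \<le> C"
    using compact_imp_bounded bounded_iff by metis
  have F: "F t \<le> C" if "t \<in> {0..b}" for t
    using C that by force
  have 1: "(\<Sum>i\<in>{1..N}. \<bar>p i t\<bar>) \<le> F t" for t
    unfolding F_def by (rule sum_mono) simp
  have 2: "\<bar>Ut t x\<bar> \<le> F t" for t x
    unfolding Ut_def F_def
  proof (rule order_trans[OF sum_abs sum_mono])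
    fix i assume "i \<in> {1..N}"
    have "\<bar>p' i t + p i t * q' i t * sgn (x - q i t)\<bar> \<le> \<bar>p' i t\<bar> + \<bar>p i t * q' i t\<bar>"
      by (rule order_trans[OF abs_triangle_ineq]) (simp add: abs_mult abs_sgn_eq)
    also have "\<dots> \<le> \<bar>p i t\<bar> + (\<bar>p' i t\<bar> + \<bar>p i t * q' i t\<bar>)" by simp
    finally show "\<bar>(p' i t + p i t * q' i t * sgn (x - q i t)) * exp (- \<bar>x - q i t\<bar>)\<bar>
        \<le> \<bar>p i t\<bar> + (\<bar>p' i t\<bar> + \<bar>p i t * q' i t\<bar>)"
      unfolding abs_mult[of _ "exp _"] by (rule order_trans[rotated]) (simp add: mult_left_le)
  qed
  show thesis
  proof (rule that[of C])
    fix t x assume t: "t \<in> {0..b}"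
    show "\<bar>U t x\<bar> \<le> C" "\<bar>V t x\<bar> \<le> C" "\<bar>Ut t x\<bar> \<le> C"
      unfolding U_def V_def
      using order_trans[OF order_trans[OF abs_peakon_sum_le 1] F[OF t]]
        order_trans[OF order_trans[OF abs_peakon_slope_le 1] F[OF t]]
        order_trans[OF 2 F[OF t]] by blast+
  qed
qed

text \<open>
  Setting amplitudes and positions to 0 outside the lifespan turns the multipeakon into a Borel function on
  the whole plane, to which Fubini applies; on the strip nothing changes.
\<close>
definition extend0 :: "(nat \<Rightarrow> real \<Rightarrow> real) \<Rightarrow> nat \<Rightarrow> real \<Rightarrow> real" where
  "extend0 f i t = indicator (time_dom T) t * f i t"

definition U_ext :: "real \<Rightarrow> real \<Rightarrow> real" where
  "U_ext t = peakon_sum {1..N} (\<lambda>i. extend0 p i t) (\<lambda>i. extend0 q i t)"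

definition V_ext :: "real \<Rightarrow> real \<Rightarrow> real" where
  "V_ext t = peakon_slope {1..N} (\<lambda>i. extend0 p i t) (\<lambda>i. extend0 q i t)"

definition Ut_ext :: "real \<Rightarrow> real \<Rightarrow> real" where
  "Ut_ext t x = (\<Sum>i\<in>{1..N}. (extend0 p' i t + extend0 p i t * extend0 q' i t * sgn (x - extend0 q i t))
     * exp (- \<bar>x - extend0 q i t\<bar>))"

lemma extension_eq:
  assumes "t \<in> time_dom T"
  shows "U_ext t = U t" "V_ext t = V t" "Ut_ext t = Ut t"
  using assms by (simp_all add: U_ext_def U_def V_ext_def V_def Ut_ext_def[abs_def] Ut_def[abs_def] extend0_def)

lemma extend0_measurable [measurable]:
  assumes "i \<in> {1..N}"
  shows "extend0 p i \<in> borel_measurable borel" "extend0 q i \<in> borel_measurable borel"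
    "extend0 p' i \<in> borel_measurable borel" "extend0 q' i \<in> borel_measurable borel"
  unfolding extend0_def[abs_def]
  by (intro time_extension_measurable p_cont q_cont p'_cont q'_cont assms)+

lemma U_ext_measurable [measurable]:
  "(\<lambda>z. U_ext (fst z) (snd z)) \<in> borel_measurable (borel \<Otimes>\<^sub>M borel)"
  unfolding U_ext_def by (rule peakon_sum_measurable_pair(1)) (rule extend0_measurable; assumption)+

lemma V_ext_measurable [measurable]:
  "(\<lambda>z. V_ext (fst z) (snd z)) \<in> borel_measurable (borel \<Otimes>\<^sub>M borel)"
  unfolding V_ext_def by (rule peakon_sum_measurable_pair(2)) (rule extend0_measurable; assumption)+

lemma Ut_ext_measurable [measurable]:
  "(\<lambda>z. Ut_ext (fst z) (snd z)) \<in> borel_measurable (borel \<Otimes>\<^sub>M borel)"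
  unfolding Ut_ext_def by measurable

lemma lebesgue_on_strip_measurable:
  assumes m: "(\<lambda>z. fe (fst z) (snd z)) \<in> borel_measurable (borel \<Otimes>\<^sub>M borel)"
    and eq: "\<And>t. t \<in> time_dom T \<Longrightarrow> fe t = f t"
  shows "(\<lambda>(t, x). f t x :: real) \<in> borel_measurable (lebesgue_on (time_dom T \<times> UNIV))"
proof -
  have "(\<lambda>z. fe (fst z) (snd z)) \<in> borel_measurable lborel"
    using m by (simp add: borel_prod)
  then have "(\<lambda>z. fe (fst z) (snd z)) \<in> borel_measurable (lebesgue_on (time_dom T \<times> UNIV))"
    by (intro measurable_restrict_space1 measurable_completion)
  then show ?thesis
    by (rule measurable_cong[THEN iffD1, rotated]) (auto simp: eq)
qed

lemma V_measurable: "V t \<in> borel_measurable borel" and U_measurable: "U t \<in> borel_measurable borel"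
  unfolding U_def V_def by measurable

lemma Linf_loc_W13_loc_U: "Linf_loc_W13_loc T U V"
  unfolding Linf_loc_W13_loc_def
proof (intro conjI allI impI)
  show "(\<lambda>(t, x). U t x) \<in> borel_measurable (lebesgue_on (time_dom T \<times> UNIV))"
    by (rule lebesgue_on_strip_measurable[OF U_ext_measurable extension_eq(1)])
  show "(\<lambda>(t, x). V t x) \<in> borel_measurable (lebesgue_on (time_dom T \<times> UNIV))"
    by (rule lebesgue_on_strip_measurable[OF V_ext_measurable extension_eq(2)])
  show "AE t in lebesgue. t \<in> time_dom T \<longrightarrow> has_weak_deriv (U t) (V t)"
    unfolding U_def V_def by (intro AE_I2 impI peakon_weak_deriv) simp
  fix J K :: "real set" assume JK: "compact J \<and> J \<subseteq> time_dom T \<and> compact K"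
  obtain b where b: "b \<in> time_dom T" "\<forall>t\<in>J. t \<le> b"
  proof (cases "J = {}")
    case True
    then show thesis using that[OF zero_in_time_dom] by simp
  next
    case False
    then show thesis using compact_attains_sup[of J] JK that by blast
  qed
  obtain C where C: "\<And>t x. t \<in> {0..b} \<Longrightarrow> \<bar>U t x\<bar> \<le> C" "\<And>t x. t \<in> {0..b} \<Longrightarrow> \<bar>V t x\<bar> \<le> C"
    using bounded_on_slab[OF b(1)] by metis
  have cube: "set_integrable lebesgue K (\<lambda>x. \<bar>f x\<bar> ^ 3)"
      "(LINT x:K|lebesgue. \<bar>f x\<bar> ^ 3) \<le> C ^ 3 * measure lborel K"
      "0 \<le> (LINT x:K|lebesgue. \<bar>f x\<bar> ^ 3)"
    if m[measurable]: "f \<in> borel_measurable borel" and fC: "\<And>x. \<bar>f x\<bar> \<le> C" for f :: "real \<Rightarrow> real"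
  proof -
    have [measurable]: "K \<in> sets borel" using JK by (blast intro: borel_compact)
    have fC3: "\<bar>f x\<bar> ^ 3 \<le> C ^ 3" for x
      using fC by (intro power_mono) auto
    have i: "integrable lborel (\<lambda>x. indicator K x *\<^sub>R (\<bar>f x\<bar> ^ 3))"
      using fC3 JK by (intro integrable_lborel_compact_support[where K = K and B = "C ^ 3"]) auto
    then show "set_integrable lebesgue K (\<lambda>x. \<bar>f x\<bar> ^ 3)"
      unfolding set_integrable_def by (subst integrable_completion) auto
    have eq: "(LINT x:K|lebesgue. \<bar>f x\<bar> ^ 3) = (LINT x|lborel. indicator K x *\<^sub>R (\<bar>f x\<bar> ^ 3))"
      unfolding set_lebesgue_integral_def by (rule integral_completion) measurable
    have iK: "integrable lborel (\<lambda>x. indicator K x *\<^sub>R C ^ 3)"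
      using JK by (intro integrable_lborel_compact_support[where K = K and B = "\<bar>C ^ 3\<bar>"]) auto
    have "(LINT x|lborel. indicator K x *\<^sub>R (\<bar>f x\<bar> ^ 3)) \<le> (LINT x|lborel. indicator K x *\<^sub>R C ^ 3)"
      using fC3 by (intro integral_mono i iK) (auto simp: indicator_def)
    also have "\<dots> = C ^ 3 * measure lborel K"
      by simp
    finally show "(LINT x:K|lebesgue. \<bar>f x\<bar> ^ 3) \<le> C ^ 3 * measure lborel K"
      unfolding eq .
    show "0 \<le> (LINT x:K|lebesgue. \<bar>f x\<bar> ^ 3)"
      unfolding eq by (intro integral_nonneg_AE) auto
  qed
  show "\<exists>C. AE t in lebesgue. t \<in> J \<longrightarrow>
           set_integrable lebesgue K (\<lambda>x. \<bar>U t x\<bar> ^ 3) \<and>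
           set_integrable lebesgue K (\<lambda>x. \<bar>V t x\<bar> ^ 3) \<and> W13_norm_on K (U t) (V t) \<le> C"
  proof (rule exI[of _ "(2 * (C ^ 3 * measure lborel K)) powr (1 / 3)"], intro AE_I2 impI conjI)
    fix t assume "t \<in> J"
    then have t: "t \<in> {0..b}" using b JK by (auto simp: time_dom_def)
    note u = cube[OF U_measurable C(1)[OF t]] and v = cube[OF V_measurable C(2)[OF t]]
    show "set_integrable lebesgue K (\<lambda>x. \<bar>U t x\<bar> ^ 3)" "set_integrable lebesgue K (\<lambda>x. \<bar>V t x\<bar> ^ 3)"
      by (rule u(1), rule v(1))
    show "W13_norm_on K (U t) (V t) \<le> (2 * (C ^ 3 * measure lborel K)) powr (1 / 3)"
      unfolding W13_norm_on_def using u(2,3) v(2,3) by (intro powr_mono2) auto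
  qed
qed

lemma source_bounds:
  obtains M where "\<And>u v. \<bar>u\<bar> \<le> C \<Longrightarrow> \<bar>v\<bar> \<le> C \<Longrightarrow> \<bar>source1 k1 k2 v\<bar> \<le> M"
    "\<And>u v. \<bar>u\<bar> \<le> C \<Longrightarrow> \<bar>v\<bar> \<le> C \<Longrightarrow> \<bar>source2 k1 k2 k3 u v\<bar> \<le> M"
    "\<And>u v. \<bar>u\<bar> \<le> C \<Longrightarrow> \<bar>v\<bar> \<le> C \<Longrightarrow> \<bar>(k1 + k2) / 3 * u ^ 3 + k3 / 2 * u ^ 2\<bar> \<le> M"
    "\<And>u v. \<bar>u\<bar> \<le> C \<Longrightarrow> \<bar>v\<bar> \<le> C \<Longrightarrow> \<bar>k1 / 3 * v ^ 3\<bar> \<le> M"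
proof -
  have c: "continuous_on UNIV (\<lambda>(u::real, v). \<bar>source1 k1 k2 v\<bar> + \<bar>source2 k1 k2 k3 u v\<bar>
      + \<bar>(k1 + k2) / 3 * u ^ 3 + k3 / 2 * u ^ 2\<bar> + \<bar>k1 / 3 * v ^ 3\<bar>)"
    unfolding source1_def source2_def split_def by (intro continuous_intros)
  obtain M where M: "\<And>u v. \<bar>u\<bar> \<le> C \<Longrightarrow> \<bar>v\<bar> \<le> C \<Longrightarrow>
      \<bar>\<bar>source1 k1 k2 v\<bar> + \<bar>source2 k1 k2 k3 u v\<bar>
      + \<bar>(k1 + k2) / 3 * u ^ 3 + k3 / 2 * u ^ 2\<bar> + \<bar>k1 / 3 * v ^ 3\<bar>\<bar> \<le> M"
    using continuous_imp_bounded_on_square[OF c, of C] by metis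
  have four: "a \<le> M" "b \<le> M" "c \<le> M" "d \<le> M"
    if "\<bar>a + b + c + d\<bar> \<le> M" "0 \<le> a" "0 \<le> b" "0 \<le> c" "0 \<le> d" for a b c d :: real
    using that by linarith+
  show thesis
    by (rule that[of M]; (drule (1) M, erule four; rule abs_ge_zero))
qed

lemma nonloc_eq:
  "nonloc1 k1 k2 V t = (\<lambda>y. source1 k1 k2 (V t y))"
  "nonloc2 k1 k2 k3 U V t = (\<lambda>y. source2 k1 k2 k3 (U t y) (V t y))"
  by (simp_all add: nonloc1_def nonloc2_def source1_def source2_def fun_eq_iff)

lemma source_measurable:
  "(\<lambda>y. source1 k1 k2 (V t y)) \<in> borel_measurable borel"
  "(\<lambda>y. source2 k1 k2 k3 (U t y) (V t y)) \<in> borel_measurable borel"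
  unfolding source1_def source2_def using U_measurable[of t] V_measurable[of t] by measurable

lemma source_bounded:
  assumes "t \<in> time_dom T"
  obtains M where "\<And>y. \<bar>source1 k1 k2 (V t y)\<bar> \<le> M" "\<And>y. \<bar>source2 k1 k2 k3 (U t y) (V t y)\<bar> \<le> M"
proof -
  have t: "t \<in> {0..t}" using assms by (simp add: time_dom_def)
  obtain C where C: "\<And>s x. s \<in> {0..t} \<Longrightarrow> \<bar>U s x\<bar> \<le> C" "\<And>s x. s \<in> {0..t} \<Longrightarrow> \<bar>V s x\<bar> \<le> C"
    using bounded_on_slab[OF assms] by metis
  obtain M where "\<And>u v. \<bar>u\<bar> \<le> C \<Longrightarrow> \<bar>v\<bar> \<le> C \<Longrightarrow> \<bar>source1 k1 k2 v\<bar> \<le> M"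
    "\<And>u v. \<bar>u\<bar> \<le> C \<Longrightarrow> \<bar>v\<bar> \<le> C \<Longrightarrow> \<bar>source2 k1 k2 k3 u v\<bar> \<le> M"
    using source_bounds[of C] by metis
  with C[OF t] show thesis by (intro that) blast+
qed

lemma nonloc_integrable:
  assumes "t \<in> time_dom T"
  shows "integrable lebesgue (\<lambda>y. pker (x - y) * nonloc1 k1 k2 V t y)"
    and "integrable lebesgue (\<lambda>y. pker (x - y) * nonloc2 k1 k2 k3 U V t y)"
proof -
  obtain M where M: "\<And>y. \<bar>source1 k1 k2 (V t y)\<bar> \<le> M" "\<And>y. \<bar>source2 k1 k2 k3 (U t y) (V t y)\<bar> \<le> M"
    using source_bounded[OF assms] by blast
  have *: "integrable lebesgue (\<lambda>y. pker (x - y) * g y)"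
    if [measurable]: "g \<in> borel_measurable borel" and "\<And>y. \<bar>g y\<bar> \<le> M" for g
  proof -
    have "(\<lambda>y. pker (x - y) * g y) \<in> borel_measurable lborel"
      unfolding pker_def by measurable
    then show ?thesis
      using conv_pker_eq_exp_primitives(1)[OF that] by (simp add: integrable_completion)
  qed
  show "integrable lebesgue (\<lambda>y. pker (x - y) * nonloc1 k1 k2 V t y)"
    "integrable lebesgue (\<lambda>y. pker (x - y) * nonloc2 k1 k2 k3 U V t y)"
    unfolding nonloc_eq by (rule *[OF source_measurable(1) M(1)], rule *[OF source_measurable(2) M(2)])
qed

definition P1 :: "real \<Rightarrow> real \<Rightarrow> real" where
  "P1 t x = (LINT y|lborel. pker (x - y) * source1 k1 k2 (V_ext t y))"

definition P2 :: "real \<Rightarrow> real \<Rightarrow> real" where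
  "P2 t x = (LINT y|lborel. pker (x - y) * source2 k1 k2 k3 (U_ext t y) (V_ext t y))"

lemma P_measurable [measurable]:
  "(\<lambda>z. P1 (fst z) (snd z)) \<in> borel_measurable (borel \<Otimes>\<^sub>M borel)"
  "(\<lambda>z. P2 (fst z) (snd z)) \<in> borel_measurable (borel \<Otimes>\<^sub>M borel)"
  unfolding P1_def P2_def
  by (rule conv_pker_measurable_pair, simp add: source1_def source2_def)+

lemma conv_eq_P:
  assumes "t \<in> time_dom T"
  shows "conv pker (\<lambda>y. source1 k1 k2 (V t y)) x = P1 t x"
    and "conv pker (\<lambda>y. source2 k1 k2 k3 (U t y) (V t y)) x = P2 t x"
  unfolding P1_def P2_def extension_eq[OF assms]
  by (rule conv_lborel[OF source_measurable(1)], rule conv_lborel[OF source_measurable(2)])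

definition flux :: "real \<Rightarrow> real \<Rightarrow> real" where
  "flux t x = (k1 + k2) / 3 * U_ext t x ^ 3 + k3 / 2 * U_ext t x ^ 2 + P2 t x"

definition local_source :: "real \<Rightarrow> real \<Rightarrow> real" where
  "local_source t x = k1 / 3 * V_ext t x ^ 3 - P1 t x"

lemma flux_local_source_measurable [measurable]:
  "(\<lambda>z. flux (fst z) (snd z)) \<in> borel_measurable (borel \<Otimes>\<^sub>M borel)"
  "(\<lambda>z. local_source (fst z) (snd z)) \<in> borel_measurable (borel \<Otimes>\<^sub>M borel)"
  unfolding flux_def local_source_def by measurable

lemma weak_integrand_eq:
  assumes "t \<in> time_dom T"
  shows "weak_integrand k1 k2 k3 T U V \<phi> t x
    = U_ext t x * dt T \<phi> t x + flux t x * dx \<phi> t x + local_source t x * \<phi> t x"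
  unfolding weak_integrand_def nonloc_eq conv_eq_P[OF assms] flux_def local_source_def extension_eq[OF assms]
  by (simp add: algebra_simps)

lemma coefficients_bounded_on_slab:
  assumes b: "b \<in> time_dom T"
  obtains C where "\<And>t x. t \<in> {0..b} \<Longrightarrow> \<bar>U_ext t x\<bar> \<le> C" "\<And>t x. t \<in> {0..b} \<Longrightarrow> \<bar>Ut_ext t x\<bar> \<le> C"
    "\<And>t x. t \<in> {0..b} \<Longrightarrow> \<bar>flux t x\<bar> \<le> C" "\<And>t x. t \<in> {0..b} \<Longrightarrow> \<bar>local_source t x\<bar> \<le> C"
proof -
  have sub: "t \<in> time_dom T" if "t \<in> {0..b}" for t
    using that by (auto intro: time_dom_downward[OF b])
  obtain C where C: "\<And>t x. t \<in> {0..b} \<Longrightarrow> \<bar>U t x\<bar> \<le> C" "\<And>t x. t \<in> {0..b} \<Longrightarrow> \<bar>V t x\<bar> \<le> C"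
    "\<And>t x. t \<in> {0..b} \<Longrightarrow> \<bar>Ut t x\<bar> \<le> C"
    using bounded_on_slab[OF b] by metis
  obtain M where M: "\<And>u v. \<bar>u\<bar> \<le> C \<Longrightarrow> \<bar>v\<bar> \<le> C \<Longrightarrow> \<bar>source1 k1 k2 v\<bar> \<le> M"
    "\<And>u v. \<bar>u\<bar> \<le> C \<Longrightarrow> \<bar>v\<bar> \<le> C \<Longrightarrow> \<bar>source2 k1 k2 k3 u v\<bar> \<le> M"
    "\<And>u v. \<bar>u\<bar> \<le> C \<Longrightarrow> \<bar>v\<bar> \<le> C \<Longrightarrow> \<bar>(k1 + k2) / 3 * u ^ 3 + k3 / 2 * u ^ 2\<bar> \<le> M"
    "\<And>u v. \<bar>u\<bar> \<le> C \<Longrightarrow> \<bar>v\<bar> \<le> C \<Longrightarrow> \<bar>k1 / 3 * v ^ 3\<bar> \<le> M"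
    using source_bounds[of C] by blast
  show thesis
  proof (rule that[of "max C (M + M)"])
    fix t x assume t: "t \<in> {0..b}"
    note e = extension_eq[OF sub[OF t]]
    have P1: "\<bar>P1 t x\<bar> \<le> M"
      unfolding P1_def e using C[OF t] M(1) by (intro abs_conv_pker_le source_measurable) blast
    have P2: "\<bar>P2 t x\<bar> \<le> M"
      unfolding P2_def e using C[OF t] M(2) by (intro abs_conv_pker_le source_measurable) blast
    show "\<bar>U_ext t x\<bar> \<le> max C (M + M)" "\<bar>Ut_ext t x\<bar> \<le> max C (M + M)"
      unfolding e using C[OF t] by (auto intro: max.coboundedI1)
    have "\<bar>flux t x\<bar> \<le> M + M"
      unfolding flux_def e using M(3)[OF C(1)[OF t, of x] C(2)[OF t, of x]] P2 by linarith
    then show "\<bar>flux t x\<bar> \<le> max C (M + M)" by simp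
    have "\<bar>local_source t x\<bar> \<le> M + M"
      unfolding local_source_def e using M(4)[OF C(1)[OF t, of x] C(2)[OF t, of x]] P1 by linarith
    then show "\<bar>local_source t x\<bar> \<le> max C (M + M)" by simp
  qed
qed

text \<open>
  Summing the formula for one moving peakon with amplitude \<open>p i t * \<phi> t x\<close> and displacement \<open>x - q i t\<close>
  gives the time derivative of the product of the multipeakon and the test function.
\<close>
lemma transport_has_integral:
  assumes \<phi>: "test_fun_strip T \<phi>" and b: "b \<in> time_dom T" and end0: "\<phi> b x = 0"
  shows "((\<lambda>t. Ut t x * \<phi> t x + U t x * dt T \<phi> t x) has_integral - (U 0 x * \<phi> 0 x)) {0..b}"
proof -
  have sub: "{0..b} \<subseteq> time_dom T"
    by (auto intro: time_dom_downward[OF b])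
  have b0: "0 \<le> b" using b by (simp add: time_dom_def)
  have slice: "continuous_on {0..b} (\<lambda>t. f t x)"
    if "continuous_on (time_dom T \<times> UNIV) (\<lambda>(t, x). f t x)" for f :: "real \<Rightarrow> real \<Rightarrow> real"
  proof -
    have "continuous_on {0..b} ((\<lambda>(t, x). f t x) \<circ> (\<lambda>t. (t, x)))"
      using sub by (intro continuous_on_compose continuous_intros continuous_on_subset[OF that]) auto
    then show ?thesis by (simp add: comp_def)
  qed
  note c\<phi> = test_fun_strip_continuous[OF \<phi>]
  have one: "((\<lambda>t. (p' i t * \<phi> t x + dt T \<phi> t x * p i t) * exp (- \<bar>x - q i t\<bar>)
        - (p i t * \<phi> t x) * (- q' i t) * sgn (x - q i t) * exp (- \<bar>x - q i t\<bar>)) has_integral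
      (p i b * \<phi> b x) * exp (- \<bar>x - q i b\<bar>) - (p i 0 * \<phi> 0 x) * exp (- \<bar>x - q i 0\<bar>)) {0..b}"
    if i: "i \<in> {1..N}" for i
  proof (rule moving_peakon_has_integral[OF b0])
    fix s assume s: "s \<in> {0..b}"
    then have sT: "s \<in> time_dom T" using sub by blast
    have "((\<lambda>t. p i t * \<phi> t x) has_real_derivative p' i s * \<phi> s x + dt T \<phi> s x * p i s)
        (at s within time_dom T)"
      by (rule DERIV_mult[OF p_deriv[OF i sT] test_fun_strip_derivs(1)[OF \<phi> sT]])
    then show "((\<lambda>t. p i t * \<phi> t x) has_real_derivative p' i s * \<phi> s x + dt T \<phi> s x * p i s)
        (at s within {0..b})"
      by (rule has_field_derivative_subset[OF _ sub])
    have "((\<lambda>t. x - q i t) has_real_derivative 0 - q' i s) (at s within time_dom T)"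
      by (rule DERIV_diff[OF DERIV_const q_deriv[OF i sT]])
    then show "((\<lambda>t. x - q i t) has_real_derivative - q' i s) (at s within {0..b})"
      using has_field_derivative_subset[OF _ sub] by fastforce
  next
    show "continuous_on {0..b} (\<lambda>t. p' i t * \<phi> t x + dt T \<phi> t x * p i t)"
      by (intro continuous_intros slice c\<phi> continuous_on_subset[OF p_cont[OF i] sub]
          continuous_on_subset[OF p'_cont[OF i] sub])
    show "continuous_on {0..b} (\<lambda>t. - q' i t)"
      by (intro continuous_intros continuous_on_subset[OF q'_cont[OF i] sub])
  qed
  have "((\<lambda>t. \<Sum>i\<in>{1..N}. (p' i t * \<phi> t x + dt T \<phi> t x * p i t) * exp (- \<bar>x - q i t\<bar>)
        - (p i t * \<phi> t x) * (- q' i t) * sgn (x - q i t) * exp (- \<bar>x - q i t\<bar>)) has_integral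
      (\<Sum>i\<in>{1..N}. (p i b * \<phi> b x) * exp (- \<bar>x - q i b\<bar>) - (p i 0 * \<phi> 0 x) * exp (- \<bar>x - q i 0\<bar>))) {0..b}"
    by (intro has_integral_sum one) simp
  moreover have "(\<Sum>i\<in>{1..N}. (p' i t * \<phi> t x + dt T \<phi> t x * p i t) * exp (- \<bar>x - q i t\<bar>)
        - (p i t * \<phi> t x) * (- q' i t) * sgn (x - q i t) * exp (- \<bar>x - q i t\<bar>))
      = Ut t x * \<phi> t x + U t x * dt T \<phi> t x" for t
    unfolding Ut_def U_def peakon_sum_def sum_distrib_right sum.distrib[symmetric]
    by (rule sum.cong) (simp_all add: algebra_simps)
  moreover have "(\<Sum>i\<in>{1..N}. (p i b * \<phi> b x) * exp (- \<bar>x - q i b\<bar>) - (p i 0 * \<phi> 0 x) * exp (- \<bar>x - q i 0\<bar>))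
      = - (U 0 x * \<phi> 0 x)"
    unfolding U_def peakon_sum_def sum_distrib_right sum_negf[symmetric] end0
    by (rule sum.cong) (simp_all add: algebra_simps)
  ultimately show ?thesis by simp
qed

lemma spatial_identity:
  assumes \<phi>: "test_fun_strip T \<phi>" and t: "t \<in> time_dom T"
    and supp: "\<And>x. R < \<bar>x\<bar> \<Longrightarrow> \<phi> t x = 0"
  shows "integrable lborel (\<lambda>x. flux t x * dx \<phi> t x + (- Ut_ext t x + local_source t x) * \<phi> t x)"
    and "(LINT x|lborel. flux t x * dx \<phi> t x + (- Ut_ext t x + local_source t x) * \<phi> t x) = 0"
proof -
  have c: "continuous_on UNIV (dx \<phi> t)"
  proof -
    have "continuous_on UNIV ((\<lambda>(t, x). dx \<phi> t x) \<circ> Pair t)"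
      using t by (intro continuous_on_compose continuous_intros
          continuous_on_subset[OF test_fun_strip_continuous(3)[OF \<phi>]]) auto
    then show ?thesis by (simp add: comp_def)
  qed
  have P: "P1 t = conv pker (\<lambda>y. source1 k1 k2 (V t y))"
    "P2 t = conv pker (\<lambda>y. source2 k1 k2 k3 (U t y) (V t y))"
    by (simp_all add: conv_eq_P[OF t] fun_eq_iff)
  note eqs = p_eq[OF _ t, folded U_def V_def] q_eq[OF _ t, folded U_def V_def]
  note id = peakon_spatial_identity[OF finite_atLeastAtMost q_inj[OF t],
      where p = "\<lambda>i. p i t" and pd = "\<lambda>i. p' i t" and qd = "\<lambda>i. q' i t" and \<psi> = "\<phi> t"
        and \<psi>' = "dx \<phi> t" and R = R,
      folded U_def V_def, OF eqs test_fun_strip_derivs(2)[OF \<phi> t] c supp,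
      folded Ut_def P]
  have E: "flux t x * dx \<phi> t x + (- Ut_ext t x + local_source t x) * \<phi> t x
      = ((k1 + k2) / 3 * U t x ^ 3 + k3 / 2 * (U t x)\<^sup>2 + P2 t x) * dx \<phi> t x
        + (- Ut t x + k1 / 3 * V t x ^ 3 - P1 t x) * \<phi> t x" for x
    unfolding flux_def local_source_def extension_eq[OF t] by simp
  show "integrable lborel (\<lambda>x. flux t x * dx \<phi> t x + (- Ut_ext t x + local_source t x) * \<phi> t x)"
    "(LINT x|lborel. flux t x * dx \<phi> t x + (- Ut_ext t x + local_source t x) * \<phi> t x) = 0"
    unfolding E using id by (simp_all only:)
qed

text \<open>
  The weak integrand \<open>Z\<close> and \<open>Y = \<partial>\<^sub>t (u \<phi>)\<close> have the same integral over almost every time slice, since their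
  difference is the integrand of the spatial identity. Integrating \<open>Y\<close> in time first leaves only the
  contribution of the initial time. All integrands are products of the test function or one of its derivatives,
  integrable on the plane, with coefficients bounded on the slab containing its support.
\<close>
lemma weak_identity:
  assumes \<phi>: "test_fun_strip T \<phi>"
  shows "set_integrable lebesgue (time_dom T \<times> UNIV)
             (\<lambda>(t, x). weak_integrand k1 k2 k3 T U V \<phi> t x)" (is ?int)
    and "integrable lebesgue (\<lambda>x. U 0 x * \<phi> 0 x)" (is ?init)
    and "(LINT t:time_dom T|lebesgue. LINT x|lebesgue. weak_integrand k1 k2 k3 T U V \<phi> t x)
             + (LINT x|lebesgue. U 0 x * \<phi> 0 x) = 0" (is ?eq)
proof -
  let ?D = "time_dom T" and ?M = "lborel \<Otimes>\<^sub>M lborel :: (real \<times> real) measure"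
  obtain b R where b: "b \<in> ?D" "0 < b"
    and z\<phi>: "\<And>t x. t \<in> ?D \<Longrightarrow> b \<le> t \<or> R < \<bar>x\<bar> \<Longrightarrow> \<phi> t x = 0"
    and zt: "\<And>t x. t \<in> ?D \<Longrightarrow> b \<le> t \<or> R < \<bar>x\<bar> \<Longrightarrow> dt T \<phi> t x = 0"
    and zx: "\<And>t x. t \<in> ?D \<Longrightarrow> b \<le> t \<or> R < \<bar>x\<bar> \<Longrightarrow> dx \<phi> t x = 0"
    using test_fun_strip_support[OF \<phi> T_pos] by blast
  note c\<phi> = test_fun_strip_continuous[OF \<phi>]
  define e where "e = (\<lambda>z. indicator ?D (fst z) * \<phi> (fst z) (snd z))"
  define et where "et = (\<lambda>z. indicator ?D (fst z) * dt T \<phi> (fst z) (snd z))"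
  define ex where "ex = (\<lambda>z. indicator ?D (fst z) * dx \<phi> (fst z) (snd z))"
  have ie: "integrable ?M e" "integrable ?M et" "integrable ?M ex"
    unfolding e_def et_def ex_def
    by (rule strip_extension_integrable[OF c\<phi>(1) b(1) z\<phi>] strip_extension_integrable[OF c\<phi>(2) b(1) zt]
        strip_extension_integrable[OF c\<phi>(3) b(1) zx], assumption+)+
  have me[measurable]: "e \<in> borel_measurable (borel \<Otimes>\<^sub>M borel)" "et \<in> borel_measurable (borel \<Otimes>\<^sub>M borel)"
      "ex \<in> borel_measurable (borel \<Otimes>\<^sub>M borel)"
    unfolding e_def et_def ex_def by (intro strip_extension_measurable c\<phi>)+
  have slab: "fst z \<in> {0..b}" if "e z \<noteq> 0 \<or> et z \<noteq> 0 \<or> ex z \<noteq> 0" for z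
  proof -
    have D: "fst z \<in> ?D" using that by (auto simp: e_def et_def ex_def indicator_def split: if_splits)
    then have "\<not> b \<le> fst z" using that z\<phi> zt zx by (auto simp: e_def et_def ex_def)
    with D show ?thesis by (auto simp: time_dom_def)
  qed
  obtain C where C: "\<And>t x. t \<in> {0..b} \<Longrightarrow> \<bar>U_ext t x\<bar> \<le> C" "\<And>t x. t \<in> {0..b} \<Longrightarrow> \<bar>Ut_ext t x\<bar> \<le> C"
    "\<And>t x. t \<in> {0..b} \<Longrightarrow> \<bar>flux t x\<bar> \<le> C" "\<And>t x. t \<in> {0..b} \<Longrightarrow> \<bar>local_source t x\<bar> \<le> C"
    using coefficients_bounded_on_slab[OF b(1)] by blast
  have prod: "integrable ?M (\<lambda>z. c (fst z) (snd z) * f z)"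
    if "integrable ?M f" "(\<lambda>z. c (fst z) (snd z)) \<in> borel_measurable (borel \<Otimes>\<^sub>M borel)"
      "\<And>t x. t \<in> {0..b} \<Longrightarrow> \<bar>c t x\<bar> \<le> C" "\<And>z. f z \<noteq> 0 \<Longrightarrow> fst z \<in> {0..b}" for c f
    using that by (intro integrable_bounded_coefficient[where B = C]) simp_all
  define Y where "Y = (\<lambda>t x. Ut_ext t x * e (t, x) + U_ext t x * et (t, x))"
  define Z where "Z = (\<lambda>t x. U_ext t x * et (t, x) + flux t x * ex (t, x) + local_source t x * e (t, x))"
  have pU_ext: "integrable ?M (\<lambda>z. U_ext (fst z) (snd z) * et z)"
    and pUt_ext: "integrable ?M (\<lambda>z. Ut_ext (fst z) (snd z) * e z)"
    and pflux: "integrable ?M (\<lambda>z. flux (fst z) (snd z) * ex z)"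
    and psource: "integrable ?M (\<lambda>z. local_source (fst z) (snd z) * e z)"
    using slab by (intro prod ie C U_ext_measurable Ut_ext_measurable flux_local_source_measurable; blast)+
  have iY: "integrable ?M (case_prod Y)"
    using Bochner_Integration.integrable_add[OF pUt_ext pU_ext] by (simp add: Y_def split_def)
  have iZ: "integrable ?M (case_prod Z)"
    using Bochner_Integration.integrable_add[OF Bochner_Integration.integrable_add[OF pU_ext pflux] psource]
    by (simp add: Z_def split_def)
  have Z: "indicator ?D t * weak_integrand k1 k2 k3 T U V \<phi> t x = Z t x" for t x
  proof (cases "t \<in> ?D")
    case True
    then show ?thesis
      using weak_integrand_eq[OF True] by (simp add: Z_def e_def et_def ex_def)
  qed (simp add: Z_def e_def et_def ex_def)
  have "integrable lborel (case_prod Z)"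
    using iZ by (simp add: lborel_prod)
  then have "integrable lebesgue (case_prod Z)"
    using integrable_completion[of "case_prod Z" lborel] borel_measurable_integrable by blast
  moreover have "case_prod Z = (\<lambda>z. indicator (?D \<times> UNIV) z *\<^sub>R (case z of (t, x) \<Rightarrow> weak_integrand k1 k2 k3 T U V \<phi> t x))"
    by (auto simp: fun_eq_iff Z[symmetric] indicator_def)
  ultimately show ?int
    unfolding set_integrable_def by simp
  have sec: "(\<lambda>x. Z t x) \<in> borel_measurable lborel" for t
  proof -
    have "case_prod Z \<in> borel_measurable (borel \<Otimes>\<^sub>M borel)"
      using borel_measurable_integrable[OF iZ] by (simp add: borel_prod lborel_prod)
    then have "(\<lambda>x. case_prod Z (t, x)) \<in> borel_measurable lborel"
      by measurable
    then show ?thesis by simp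
  qed
  have "AE t in lborel. (LINT x|lborel. Z t x) = (LINT x|lborel. Y t x)"
    using lborel_pair.AE_integrable_fst[OF iY]
  proof eventually_elim
    case (elim t)
    show ?case
    proof (cases "t \<in> ?D")
      case True
      have "Z t x = Y t x + (flux t x * dx \<phi> t x + (- Ut_ext t x + local_source t x) * \<phi> t x)" for x
        using True by (simp add: Z_def Y_def e_def et_def ex_def algebra_simps)
      then have "(LINT x|lborel. Z t x)
          = (LINT x|lborel. Y t x + (flux t x * dx \<phi> t x + (- Ut_ext t x + local_source t x) * \<phi> t x))"
        by simp
      also have "\<dots> = (LINT x|lborel. Y t x) + 0"
        using spatial_identity[OF \<phi> True, of R] z\<phi>[OF True] elim
        by (subst Bochner_Integration.integral_add) auto
      finally show ?thesis by simp
    next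
      case False
      then show ?thesis by (simp add: Z_def Y_def e_def et_def ex_def)
    qed
  qed
  then have ZY: "(LINT t|lborel. LINT x|lborel. Z t x) = (LINT t|lborel. LINT x|lborel. Y t x)"
    using borel_measurable_integrable[OF lborel_pair.integrable_fst[OF iZ]]
      borel_measurable_integrable[OF lborel_pair.integrable_fst[OF iY]]
    by (intro integral_cong_AE) simp_all
  have c0: "continuous_on UNIV (\<lambda>x. U 0 x * \<phi> 0 x)"
    using isCont_peakon_sum DERIV_isCont[OF test_fun_strip_derivs(2)[OF \<phi> zero_in_time_dom]]
    by (auto simp: continuous_on_eq_continuous_at U_def intro!: continuous_mult)
  then have m0: "(\<lambda>x. U 0 x * \<phi> 0 x) \<in> borel_measurable lborel"
    using borel_measurable_continuous_onI by simp
  have slice: "AE x in lborel. (LINT t|lborel. Y t x) = - (U 0 x * \<phi> 0 x)"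
    using lborel_pair.AE_integrable_snd[OF iY]
  proof eventually_elim
    case (elim x)
    have "((\<lambda>t. Ut t x * \<phi> t x + U t x * dt T \<phi> t x) has_integral - (U 0 x * \<phi> 0 x)) {0..b}"
      using b z\<phi> by (intro transport_has_integral[OF \<phi>]) auto
    moreover have "Y t x = Ut t x * \<phi> t x + U t x * dt T \<phi> t x" if "t \<in> {0..b}" for t
    proof -
      have "t \<in> ?D" using that by (auto intro: time_dom_downward[OF b(1)])
      then show ?thesis by (simp add: Y_def e_def et_def extension_eq)
    qed
    ultimately have "((\<lambda>t. Y t x) has_integral - (U 0 x * \<phi> 0 x)) {0..b}"
      by (rule has_integral_eq[rotated, OF _ sym])
    moreover have "Y t x = 0" if "t \<notin> {0..b}" for t
    proof -
      have "e (t, x) = 0" "et (t, x) = 0"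
        using slab[of "(t, x)"] that unfolding fst_conv by blast+
      then show ?thesis by (simp add: Y_def)
    qed
    ultimately have "((\<lambda>t. Y t x) has_integral - (U 0 x * \<phi> 0 x)) UNIV"
      by (rule has_integral_on_superset) auto
    with has_integral_integral_lborel[OF elim] show ?case
      by (rule has_integral_unique)
  qed
  have iYx: "integrable lborel (\<lambda>x. LINT t|lborel. Y t x)"
    by (rule lborel_pair.integrable_snd[OF iY])
  have "integrable lborel (\<lambda>x. - (U 0 x * \<phi> 0 x))"
    using m0 by (intro integrable_cong_AE_imp[OF iYx _ slice]) simp
  then have "integrable lborel (\<lambda>x. U 0 x * \<phi> 0 x)" by simp
  then show ?init using integrable_completion[OF m0] by simp
  have "(LINT t:?D|lebesgue. LINT x|lebesgue. weak_integrand k1 k2 k3 T U V \<phi> t x)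
      = (LINT t|lebesgue. LINT x|lborel. Z t x)"
    unfolding set_lebesgue_integral_def
  proof (rule Bochner_Integration.integral_cong[OF refl])
    fix t
    have "indicator ?D t *\<^sub>R (LINT x|lebesgue. weak_integrand k1 k2 k3 T U V \<phi> t x) = (LINT x|lebesgue. Z t x)"
      by (simp flip: Z)
    then show "indicator ?D t *\<^sub>R (LINT x|lebesgue. weak_integrand k1 k2 k3 T U V \<phi> t x) = (LINT x|lborel. Z t x)"
      using integral_completion[OF sec] by simp
  qed
  also have "\<dots> = (LINT t|lborel. LINT x|lborel. Z t x)"
    by (rule integral_completion[OF borel_measurable_integrable[OF lborel_pair.integrable_fst[OF iZ]]])
  also have "\<dots> = (LINT x|lborel. LINT t|lborel. Y t x)"
    unfolding ZY by (rule lborel_pair.Fubini_integral[OF iY, symmetric])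
  also have "\<dots> = (LINT x|lborel. - (U 0 x * \<phi> 0 x))"
    using slice borel_measurable_integrable[OF iYx] m0 by (intro integral_cong_AE) simp_all
  also have "\<dots> = - (LINT x|lebesgue. U 0 x * \<phi> 0 x)"
    using integral_completion[OF m0] by simp
  finally show ?eq by simp
qed

lemma weak_solution_U: "weak_solution k1 k2 k3 T (U 0) U"
  unfolding weak_solution_def
proof (intro conjI exI[of _ V])
  show "U 0 \<in> W13"
    unfolding U_def by (rule peakon_sum_in_W13) simp
qed (use Linf_loc_W13_loc_U nonloc_integrable weak_identity in \<open>auto intro!: AE_I2\<close>)

end

theorem proposition1p2:
  fixes k1 k2 k3 :: real and N :: nat and T :: ereal
    and p q p' q' :: "nat \<Rightarrow> real \<Rightarrow> real"
  assumes "N \<ge> 1" and "T > 0"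
    and p_C1: "\<forall>i\<in>{1..N}. continuous_on (time_dom T) (p' i) \<and>
          (\<forall>t\<in>time_dom T. (p i has_real_derivative p' i t) (at t within time_dom T))"
    and q_C1: "\<forall>i\<in>{1..N}. continuous_on (time_dom T) (q' i) \<and>
          (\<forall>t\<in>time_dom T. (q i has_real_derivative q' i t) (at t within time_dom T))"
    and ordered: "\<forall>t\<in>time_dom T. \<forall>i\<in>{1..<N}. q i t < q (Suc i) t"
    and p_ode: "\<forall>t\<in>time_dom T. \<forall>i\<in>{1..N}.
          p' i t = p i t *
            (\<Sum>j=1..N. p j t * sgn (q i t - q j t) * exp (- \<bar>q i t - q j t\<bar>)
               * (k2 * (\<Sum>k=1..N. p k t * exp (- \<bar>q i t - q k t\<bar>)) + k3))"
    and q_ode: "\<forall>t\<in>time_dom T. \<forall>i\<in>{1..N}.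
          q' i t = - (k1 / 3) * (p i t)\<^sup>2
            - k1 * (\<Sum>j=1..N. p j t * sgn (q i t - q j t) * exp (- \<bar>q i t - q j t\<bar>))\<^sup>2
            + (k1 + k2) * (\<Sum>j=1..N. p j t * exp (- \<bar>q i t - q j t\<bar>))\<^sup>2
            + k3 * (\<Sum>j=1..N. p j t * exp (- \<bar>q i t - q j t\<bar>))"
  shows "weak_solution k1 k2 k3 T (multipeakon N p q 0) (multipeakon N p q)"
proof -
  have "multipeakon_flow k1 k2 k3 N T p q p' q'"
  proof unfold_locales
    show "0 < T" by fact
    fix t assume t: "t \<in> time_dom T"
    have less: "q i t < q j t" if "1 \<le> i" "i < j" "j \<le> N" for i j
      using that(2,1,3)
    proof (induction rule: strict_inc_induct)
      case (base i)
      then show ?case using ordered t by auto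
    next
      case (step i)
      then have "q i t < q (Suc i) t" using ordered t by auto
      with step show ?case by (auto intro: less_trans)
    qed
    show "inj_on (\<lambda>i. q i t) {1..N}"
    proof (rule inj_onI, rule ccontr)
      fix i j assume "i \<in> {1..N}" "j \<in> {1..N}" "q i t = q j t" "i \<noteq> j"
      then show False using less[of i j] less[of j i] by (auto elim: linorder_neqE_nat)
    qed
  next
    fix i t assume "i \<in> {1..N}" "t \<in> time_dom T"
    then show "p' i t = - p i t * peakon_slope {1..N} (\<lambda>j. p j t) (\<lambda>j. q j t) (q i t)
        * (k2 * peakon_sum {1..N} (\<lambda>j. p j t) (\<lambda>j. q j t) (q i t) + k3)"
      using p_ode by (simp add: peakon_slope_def peakon_sum_def flip: sum_distrib_right)
    from \<open>i \<in> {1..N}\<close> \<open>t \<in> time_dom T\<close>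
    show "q' i t = - (k1 / 3) * (p i t)\<^sup>2
        - k1 * (peakon_slope {1..N} (\<lambda>j. p j t) (\<lambda>j. q j t) (q i t))\<^sup>2
        + (k1 + k2) * (peakon_sum {1..N} (\<lambda>j. p j t) (\<lambda>j. q j t) (q i t))\<^sup>2
        + k3 * peakon_sum {1..N} (\<lambda>j. p j t) (\<lambda>j. q j t) (q i t)"
      using q_ode by (simp add: peakon_slope_def peakon_sum_def)
  qed (use p_C1 q_C1 in blast)+
  then show ?thesis
    by (metis multipeakon_flow.weak_solution_U multipeakon_flow.multipeakon_eq)
qed

end
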